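(* Let $m<\infty$. The representations $V_{\boldsymbol{\lambda}}$, where $\boldsymbol{\lambda}$ runs over the set $\mathcal{P}(d,m,n)$, are irreducible pairwise non-isomorphic representations of $\mathcal{F}_m\mathrm{Y}(d,m,n)$.
   Context: Algebra. Let $d,n,m\in\mathbb{Z}_{>0}$. Let $q,v_1,\ldots,v_m$ be indeterminates, $\mathcal{R}_m:=\mathbb{C}[q^{\pm1},v_1^{\pm1},\ldots,v_m^{\pm1}]$, and $\mathcal{F}_m$ its field of fractions. The cyclotomic Yokonuma--Hecke algebra $\mathrm{Y}(d,m,n)$ is the associative $\mathcal{R}_m$-algebra generated by $t_1,\ldots,t_n,g_1,\ldots,g_{n-1},X_1^{\pm1}$ with relations: $g_ig_j=g_jg_i$ if $|i-j|>1$; $g_ig_{i+1}g_i=g_{i+1}g_ig_{i+1}$; $t_it_j=t_jt_i$; $t_jg_i=g_it_{s_i(j)}$ with $s_i=(i,i+1)$; $t_j^d=1$; $g_i^2=1+(q-q^{-1})e_ig_i$ with $e_i:=\frac1d\sum_{s=0}^{d-1}t_i^st_{i+1}^{-s}$; $X_1g_1X_1g_1=g_1X_1g_1X_1$; $X_1g_i=g_iX_1$ for $i\ge2$; $X_1t_j=t_jX_1$ for all $j$; and $(X_1-v_1)\cdots(X_1-v_m)=0$. Put $\mathcal{F}_m\mathrm{Y}(d,m,n):=\mathcal{F}_m\otimes_{\mathcal{R}_m}\mathrm{Y}(d,m,n)$. Combinatorics. A $(d,m)$-partition of size $n$ is a $d$-tuple of $m$-tuples of partitions (identified with Young diagrams)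 with $n$ nodes in total; the $l$-th partition of the $k$-th $m$-tuple has position $(k,l)$. $\mathcal{P}(d,m,n)$ is the set of all $(d,m)$-partitions of size $n$. A $(d,m)$-node is a triple $\boldsymbol{\theta}=((x,y),k,l)$, consisting of a node in row $x$, column $y$, and a position $(k,l)$, $1\le k\le d$, $1\le l\le m$; set $\mathrm{p}^{(d)}(\boldsymbol\theta):=k$ and $\mathrm{c}(\boldsymbol\theta):=v_lq^{2(y-x)}$. A $(d,m)$-tableau of shape $\boldsymbol\lambda$ is a bijection between $\{1,\ldots,n\}$ and the $(d,m)$-nodes of $\boldsymbol\lambda$; it is standard if its entries increase along rows and down columns of every diagram. $\mathrm{p}^{(d)}(\mathcal{T}|i)$ and $\mathrm{c}(\mathcal{T}|i)$ denote $\mathrm{p}^{(d)}$ and $\mathrm{c}$ of the $(d,m)$-node of $\mathcal{T}$ containing $i$. $\mathcal{T}^\sigma$ is obtained from $\mathcal{T}$ by applying $\sigma\in\mathfrak{S}_n$ to its entries. $\{\xi_1,\ldots,\xi_d\}\subset\mathbb{C}$ is the set of all $d$-th roots of unity, ordered arbitrarily. Representations. For $\boldsymbol\lambda\in\mathcal{P}(d,m,n)$, $V_{\boldsymbol\lambda}$ is the $\mathcal{F}_m$-vector space with basis $\{\mathbf{v}_{\mathcal{T}}\}$ indexed by the standard $(d,m)$-tableaux of shape $\boldsymbol\lambda$ (with $\mathbf{v}_{\mathcal{T}}:=0$ for $\mathcal{T}$ non-standard), on which $\mathcal{F}_m\mathrm{Y}(d,m,n)$ acts as follows. With $\mathrm{p}_i:=\mathrm{p}^{(d)}(\mathcal{T}|i)$,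 $\mathrm{c}_i:=\mathrm{c}(\mathcal{T}|i)$: $X_1(\mathbf{v}_{\mathcal{T}})=\mathrm{c}_1\mathbf{v}_{\mathcal{T}}$; $t_j(\mathbf{v}_{\mathcal{T}})=\xi_{\mathrm{p}_j}\mathbf{v}_{\mathcal{T}}$; $g_i(\mathbf{v}_{\mathcal{T}})=\mathbf{v}_{\mathcal{T}^{s_i}}$ if $\mathrm{p}_i\ne\mathrm{p}_{i+1}$; and $g_i(\mathbf{v}_{\mathcal{T}})=\frac{\mathrm{c}_{i+1}(q-q^{-1})}{\mathrm{c}_{i+1}-\mathrm{c}_i}\mathbf{v}_{\mathcal{T}}+\frac{q\mathrm{c}_{i+1}-q^{-1}\mathrm{c}_i}{\mathrm{c}_{i+1}-\mathrm{c}_i}\mathbf{v}_{\mathcal{T}^{s_i}}$ if $\mathrm{p}_i=\mathrm{p}_{i+1}$. *)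

theory Defs
  imports
    "HOL-Library.Poly_Mapping"
    "HOL-Library.Option_ord"
    "HOL-Library.FuncSet"
    "HOL-Combinatorics.Transposition"
    "HOL-Computational_Algebra.Polynomial_Factorial"
    "HOL-Algebra.Module"
    "HOL-Algebra.QuotRing"
    "HOL-Algebra.Free_Abelian_Groups"
    Complex_Main
begin

section \<open>Coefficients\<close>

text \<open>
  The number m of indeterminates \<open>v\<close> is the cardinality of the index type \<open>'m\<close>; \<open>'m laurent\<close> is the
  group algebra over the complex numbers of the free abelian group on \<open>'m option\<close>, i.e. the ring of
  Laurent polynomials in \<open>q\<close> (index \<open>None\<close>) and the \<open>v\<^sub>l\<close> (index \<open>Some l\<close>).  The order on \<open>'m\<close>
  plays no mathematical role: the library needs one to know that this ring is an integral domain.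
\<close>

type_synonym 'm laurent = "('m option \<Rightarrow>\<^sub>0 int) \<Rightarrow>\<^sub>0 complex"
type_synonym 'm ratfun = "'m laurent fract"

definition laurent_const :: "complex \<Rightarrow> 'm::{finite,linorder} laurent" where
  "laurent_const z = Poly_Mapping.single 0 z"

definition laurent_q :: "int \<Rightarrow> 'm::{finite,linorder} laurent" where
  "laurent_q k = Poly_Mapping.single (Poly_Mapping.single None k) 1"  \<comment> \<open>\<open>q\<close> to the power \<open>k\<close>\<close>

definition laurent_v :: "'m::{finite,linorder} \<Rightarrow> 'm laurent" where
  "laurent_v l = Poly_Mapping.single (Poly_Mapping.single (Some l) 1) 1"


section \<open>Associative algebras\<close>

text \<open>
  An associative algebra is a \<open>module\<close> record, whose \<open>mult\<close> and \<open>one\<close> are the ring structure and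
  whose \<open>smult\<close> is the action of the scalars.
\<close>

datatype 'x free_monoid = Word (letters: "'x list")

instantiation free_monoid :: (type) monoid_add
begin

definition zero_free_monoid :: "'a free_monoid" where
  "0 = Word []"

definition plus_free_monoid :: "'a free_monoid \<Rightarrow> 'a free_monoid \<Rightarrow> 'a free_monoid" where
  "u + w = Word (letters u @ letters w)"

instance
  by standard (simp_all add: zero_free_monoid_def plus_free_monoid_def)

end

definition free_algebra ::
    "'x set \<Rightarrow> ('r::comm_ring_1, 'x free_monoid \<Rightarrow>\<^sub>0 'r) module" where
  "free_algebra S =
    \<lparr>carrier = {p. \<forall>w \<in> Poly_Mapping.keys p. set (letters w) \<subseteq> S},
     monoid.mult = (*), one = 1, ring.zero = 0, add = (+),
     smult = (\<lambda>r p. Poly_Mapping.single 0 r * p)\<rparr>"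

lemma free_algebra_ring: "ring (free_algebra S :: ('r::comm_ring_1, 'x free_monoid \<Rightarrow>\<^sub>0 'r) module)"
proof -
  let ?C = "{p :: 'x free_monoid \<Rightarrow>\<^sub>0 'r. \<forall>w \<in> Poly_Mapping.keys p. set (letters w) \<subseteq> S}"
  have add: "x + y \<in> ?C" if "x \<in> ?C" "y \<in> ?C" for x y
    using that Poly_Mapping.keys_add[of x y] by blast
  have mult: "x * y \<in> ?C" if x: "x \<in> ?C" and y: "y \<in> ?C" for x y
  proof (rule CollectI, rule ballI)
    fix w assume "w \<in> Poly_Mapping.keys (x * y)"
    then obtain u v where "u \<in> Poly_Mapping.keys x" "v \<in> Poly_Mapping.keys y" "w = u + v"
      using keys_mult[of x y] by blast
    moreover from this have "set (letters u) \<subseteq> S" "set (letters v) \<subseteq> S"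
      using x y by blast+
    ultimately show "set (letters w) \<subseteq> S"
      by (simp add: plus_free_monoid_def)
  qed
  have neg: "- x \<in> ?C" if "x \<in> ?C" for x
    using that by simp
  have zero: "0 \<in> ?C" and one: "1 \<in> ?C"
    by (simp_all add: zero_free_monoid_def)
  show ?thesis
    unfolding free_algebra_def
  proof (rule ringI, goal_cases)
    case 1
    show ?case
    proof (rule abelian_groupI, goal_cases)
      case (6 x)
      then show ?case by (intro bexI[of _ "- x"]) (use neg in \<open>simp_all del: mem_Collect_eq\<close>)
    qed (use add zero in \<open>simp_all del: mem_Collect_eq add: add.assoc add.commute\<close>)
  next
    case 2
    show ?case
      by (rule Group.monoidI) (use mult one in \<open>simp_all del: mem_Collect_eq add: mult.assoc\<close>)
  qed (simp_all add: distrib_left distrib_right)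
qed

abbreviation letter :: "'x \<Rightarrow> 'x free_monoid \<Rightarrow>\<^sub>0 'r::comm_ring_1" where
  "letter x \<equiv> Poly_Mapping.single (Word [x]) 1"

abbreviation scalar :: "'r \<Rightarrow> 'x free_monoid \<Rightarrow>\<^sub>0 'r::comm_ring_1" where
  "scalar r \<equiv> Poly_Mapping.single 0 r"

definition quotient_algebra :: "('r, 'a) module \<Rightarrow> 'a set \<Rightarrow> ('r, 'a set) module" where
  "quotient_algebra A I =
    ring.extend (A Quot I)
      (module.fields (\<lambda>r C. \<Union>a\<in>C. I +>\<^bsub>A\<^esub> (r \<odot>\<^bsub>A\<^esub> a)))"

text \<open>
  Extension of scalars of an \<open>'r\<close>-algebra \<open>A\<close> along a ring homomorphism \<open>h\<close> into \<open>'f\<close>.  The tensor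
  product of \<open>'f\<close> and \<open>A\<close> over \<open>'r\<close> is the free abelian group on the pairs \<open>(f, a)\<close>, modulo the
  subgroup generated by the usual relators. The multiplication and the scalar action below are the
  biadditive, resp. additive, extensions of \<open>(f, a) (g, b) = (f g, a b)\<close> and \<open>f (g, a) = (f g, a)\<close>.
\<close>

definition formal_tensors ::
    "('r, 'a) module \<Rightarrow> ('f::comm_ring_1, ('f \<times> 'a) \<Rightarrow>\<^sub>0 int) module" where
  "formal_tensors A =
    \<lparr>carrier = carrier (free_Abelian_group (UNIV \<times> carrier A)),
     monoid.mult = (\<lambda>x y. frag_extend
       (\<lambda>(f, a). frag_extend (\<lambda>(g, b). frag_of (f * g, a \<otimes>\<^bsub>A\<^esub> b)) y) x),
     one = frag_of (1, \<one>\<^bsub>A\<^esub>), ring.zero = 0, add = (+),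
     smult = (\<lambda>f. frag_extend (\<lambda>(g, a). frag_of (f * g, a)))\<rparr>"

definition tensor_relators ::
    "('r \<Rightarrow> 'f::comm_ring_1) \<Rightarrow> ('r, 'a) module \<Rightarrow> (('f \<times> 'a) \<Rightarrow>\<^sub>0 int) set" where
  "tensor_relators h A =
    {frag_of (f + g, a) - frag_of (f, a) - frag_of (g, a) | f g a. a \<in> carrier A} \<union>
    {frag_of (f, a \<oplus>\<^bsub>A\<^esub> b) - frag_of (f, a) - frag_of (f, b) | f a b.
       a \<in> carrier A \<and> b \<in> carrier A} \<union>
    {frag_of (f * h r, a) - frag_of (f, r \<odot>\<^bsub>A\<^esub> a) | f r a. a \<in> carrier A}"

definition tensor_subgroup ::
    "('r \<Rightarrow> 'f::comm_ring_1) \<Rightarrow> ('r, 'a) module \<Rightarrow> (('f \<times> 'a) \<Rightarrow>\<^sub>0 int) set" where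
  "tensor_subgroup h A =
    generate (free_Abelian_group (UNIV \<times> carrier A)) (tensor_relators h A)"

definition extend_scalars ::
    "('r \<Rightarrow> 'f::comm_ring_1) \<Rightarrow> ('r, 'a) module \<Rightarrow> ('f, (('f \<times> 'a) \<Rightarrow>\<^sub>0 int) set) module" where
  "extend_scalars h A = quotient_algebra (formal_tensors A) (tensor_subgroup h A)"

definition pure_tensor ::
    "('r \<Rightarrow> 'f::comm_ring_1) \<Rightarrow> ('r, 'a) module \<Rightarrow> 'f \<Rightarrow> 'a \<Rightarrow> (('f \<times> 'a) \<Rightarrow>\<^sub>0 int) set" where
  "pure_tensor h A f a = tensor_subgroup h A +>\<^bsub>formal_tensors A\<^esub> frag_of (f, a)"


section \<open>The cyclotomic Yokonuma--Hecke algebra\<close>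

datatype yh_gen = Gen_t nat | Gen_g nat | Gen_X | Gen_Xinv

definition yh_gens :: "nat \<Rightarrow> yh_gen set" where
  "yh_gens n = Gen_t ` {1..n} \<union> Gen_g ` {1..<n} \<union> {Gen_X, Gen_Xinv}"

type_synonym 'm yh_free = "yh_gen free_monoid \<Rightarrow>\<^sub>0 'm laurent"

abbreviation yh_t :: "nat \<Rightarrow> 'm::{finite,linorder} yh_free" where "yh_t j \<equiv> letter (Gen_t j)"
abbreviation yh_g :: "nat \<Rightarrow> 'm::{finite,linorder} yh_free" where "yh_g i \<equiv> letter (Gen_g i)"
abbreviation yh_X :: "'m::{finite,linorder} yh_free" where "yh_X \<equiv> letter Gen_X"
abbreviation yh_Xinv :: "'m::{finite,linorder} yh_free" where "yh_Xinv \<equiv> letter Gen_Xinv"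

text \<open>
  In \<open>yh_e\<close>, the power \<open>-s\<close> of \<open>t\<^sub>i\<^sub>+\<^sub>1\<close> is written as the power \<open>d - s\<close>; they agree modulo the
  relation that the \<open>d\<close>-th power of \<open>t\<^sub>i\<^sub>+\<^sub>1\<close> is 1.
\<close>

definition yh_e :: "nat \<Rightarrow> nat \<Rightarrow> 'm::{finite,linorder} yh_free" where
  "yh_e d i = scalar (laurent_const (1 / of_nat d)) * (\<Sum>s<d. yh_t i ^ s * yh_t (i + 1) ^ (d - s))"

inductive_set yh_relators :: "nat \<Rightarrow> nat \<Rightarrow> 'm::{finite,linorder} yh_free set"
  for d n where
  g_far: "\<lbrakk>1 \<le> i; i < n; 1 \<le> j; j < n; i + 1 < j \<or> j + 1 < i\<rbrakk> \<Longrightarrow>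
      yh_g i * yh_g j - yh_g j * yh_g i \<in> yh_relators d n"
| g_braid: "\<lbrakk>1 \<le> i; i + 1 < n\<rbrakk> \<Longrightarrow>
      yh_g i * yh_g (i + 1) * yh_g i - yh_g (i + 1) * yh_g i * yh_g (i + 1) \<in> yh_relators d n"
| t_t: "\<lbrakk>1 \<le> i; i \<le> n; 1 \<le> j; j \<le> n\<rbrakk> \<Longrightarrow>
      yh_t i * yh_t j - yh_t j * yh_t i \<in> yh_relators d n"
| t_g: "\<lbrakk>1 \<le> j; j \<le> n; 1 \<le> i; i < n\<rbrakk> \<Longrightarrow>
      yh_t j * yh_g i - yh_g i * yh_t (transpose i (i + 1) j) \<in> yh_relators d n"
| t_order: "\<lbrakk>1 \<le> j; j \<le> n\<rbrakk> \<Longrightarrow> yh_t j ^ d - 1 \<in> yh_relators d n"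
| g_square: "\<lbrakk>1 \<le> i; i < n\<rbrakk> \<Longrightarrow>
      yh_g i ^ 2 - (1 + scalar (laurent_q 1 - laurent_q (-1)) * yh_e d i * yh_g i)
        \<in> yh_relators d n"
| X_inverse_right: "yh_X * yh_Xinv - 1 \<in> yh_relators d n"
| X_inverse_left: "yh_Xinv * yh_X - 1 \<in> yh_relators d n"
| X_g1: "1 < n \<Longrightarrow>
      yh_X * yh_g 1 * yh_X * yh_g 1 - yh_g 1 * yh_X * yh_g 1 * yh_X \<in> yh_relators d n"
| X_g: "\<lbrakk>2 \<le> i; i < n\<rbrakk> \<Longrightarrow> yh_X * yh_g i - yh_g i * yh_X \<in> yh_relators d n"
| X_t: "\<lbrakk>1 \<le> j; j \<le> n\<rbrakk> \<Longrightarrow> yh_X * yh_t j - yh_t j * yh_X \<in> yh_relators d n"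
| X_cyclotomic:
      "prod_list (map (\<lambda>l. yh_X - scalar (laurent_v l)) (sorted_list_of_set UNIV))
        \<in> yh_relators d n"  \<comment> \<open>the factors commute, so their order is immaterial\<close>

definition yh_free_algebra :: "nat \<Rightarrow> ('m::{finite,linorder} laurent, 'm yh_free) module" where
  "yh_free_algebra n = free_algebra (yh_gens n)"

definition yh_ideal :: "nat \<Rightarrow> nat \<Rightarrow> 'm::{finite,linorder} yh_free set" where
  "yh_ideal d n = Idl\<^bsub>yh_free_algebra n\<^esub> (yh_relators d n)"

text \<open>
  The next fact and \<open>free_algebra_ring\<close> ensure that \<open>Idl\<close> above is not an intersection over an empty
  family.
\<close>

lemma yh_relators_subset:
  "yh_relators d n \<subseteq> carrier (yh_free_algebra n :: ('m::{finite,linorder} laurent, 'm yh_free) module)"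
proof -
  interpret R: ring "yh_free_algebra n :: ('m laurent, 'm yh_free) module"
    unfolding yh_free_algebra_def by (rule free_algebra_ring)
  define C where "C = carrier (yh_free_algebra n :: ('m laurent, 'm yh_free) module)"
  have C_iff: "p \<in> C \<longleftrightarrow> (\<forall>w \<in> Poly_Mapping.keys p. set (letters w) \<subseteq> yh_gens n)" for p
    by (simp add: C_def yh_free_algebra_def free_algebra_def)
  have m: "x * y \<in> C" if "x \<in> C" "y \<in> C" for x y
  proof -
    have "x \<otimes>\<^bsub>yh_free_algebra n\<^esub> y = x * y"
      by (simp add: yh_free_algebra_def free_algebra_def)
    then show ?thesis
      using R.m_closed that unfolding C_def by metis
  qed
  have a: "x + y \<in> C" if "x \<in> C" "y \<in> C" for x y
  proof -
    have "x \<oplus>\<^bsub>yh_free_algebra n\<^esub> y = x + y"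
      by (simp add: yh_free_algebra_def free_algebra_def)
    then show ?thesis
      using R.a_closed that unfolding C_def by metis
  qed
  have o: "1 \<in> C" and z: "0 \<in> C"
    by (simp_all add: C_iff zero_free_monoid_def)
  have s: "scalar r \<in> C" for r
    by (simp add: C_iff zero_free_monoid_def)
  have u: "x - y \<in> C" if "x \<in> C" "y \<in> C" for x y
  proof -
    have "- y \<in> C"
      using that(2) by (simp add: C_iff)
    from a[OF that(1) this] show ?thesis
      by simp
  qed
  have pw: "x ^ k \<in> C" if "x \<in> C" for x k
    by (induction k) (simp_all add: m o that)
  have sm: "sum f A \<in> C" if "\<And>x. x \<in> A \<Longrightarrow> f x \<in> C" for f and A :: "nat set"
    using that by (induction A rule: infinite_finite_induct) (simp_all add: a z)
  have let_mem: "letter x \<in> C" if "x \<in> yh_gens n" for x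
    using that by (simp add: C_iff)
  have t: "yh_t i \<in> C" if "1 \<le> i" "i \<le> n" for i
    using that by (intro let_mem) (simp add: yh_gens_def)
  have g: "yh_g i \<in> C" if "1 \<le> i" "i < n" for i
    using that by (intro let_mem) (simp add: yh_gens_def)
  have X: "yh_X \<in> C" "yh_Xinv \<in> C"
    by (intro let_mem; simp add: yh_gens_def)+
  have e: "yh_e d i \<in> C" if "1 \<le> i" "i < n" for i
    unfolding yh_e_def using that by (intro m s sm pw t) simp_all
  have pl: "prod_list (map (\<lambda>l. yh_X - scalar (laurent_v l)) xs) \<in> C" for xs :: "'m list"
  proof (induction xs)
    case (Cons l xs)
    then show ?case
      using m[OF u[OF X(1) s]] by simp
  qed (simp add: o)
  have "p \<in> C" if "p \<in> yh_relators d n" for p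
    using that
  proof (cases rule: yh_relators.cases)
    case (t_g j i)
    have "1 \<le> transpose i (i + 1) j" "transpose i (i + 1) j \<le> n"
      using t_g(2-) by (simp_all add: transpose_def)
    then show ?thesis
      unfolding t_g(1) by (intro u m t g t_g(2-))
  next
    case X_cyclotomic
    show ?thesis
      unfolding X_cyclotomic by (rule pl)
  next
    case (g_far i j)
    show ?thesis
      unfolding g_far(1) by (intro u m a o s pw t g X e) (use g_far(2-) in linarith)+
  next
    case (g_braid i)
    show ?thesis
      unfolding g_braid(1) by (intro u m a o s pw t g X e) (use g_braid(2-) in linarith)+
  next
    case (t_t i j)
    show ?thesis
      unfolding t_t(1) by (intro u m a o s pw t g X e) (use t_t(2-) in linarith)+
  next
    case (t_order j)
    show ?thesis
      unfolding t_order(1) by (intro u m a o s pw t g X e) (use t_order(2-) in linarith)+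
  next
    case (g_square i)
    show ?thesis
      unfolding g_square(1) by (intro u m a o s pw t g X e) (use g_square(2-) in linarith)+
  next
    case X_inverse_right
    show ?thesis
      unfolding X_inverse_right by (intro u m a o s pw t g X e)
  next
    case X_inverse_left
    show ?thesis
      unfolding X_inverse_left by (intro u m a o s pw t g X e)
  next
    case X_g1
    show ?thesis
      unfolding X_g1(1) by (intro u m a o s pw t g X e) (use X_g1(2-) in linarith)+
  next
    case (X_g i)
    show ?thesis
      unfolding X_g(1) by (intro u m a o s pw t g X e) (use X_g(2-) in linarith)+
  next
    case (X_t j)
    show ?thesis
      unfolding X_t(1) by (intro u m a o s pw t g X e) (use X_t(2-) in linarith)+
  qed
  then show ?thesis
    unfolding C_def by (rule subsetI)
qed

definition yh_algebra ::
    "nat \<Rightarrow> nat \<Rightarrow> ('m::{finite,linorder} laurent, 'm yh_free set) module" where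
  "yh_algebra d n = quotient_algebra (yh_free_algebra n) (yh_ideal d n)"

text \<open>\<open>frac_yh_algebra d n\<close> is \<open>\<F>\<^sub>mY(d,m,n)\<close>, and \<open>frac_yh_elem d n p\<close> is the image in it of \<open>p\<close>.\<close>

type_synonym 'm frac_yh = "(('m ratfun \<times> 'm yh_free set) \<Rightarrow>\<^sub>0 int) set"

definition frac_yh_algebra ::
    "nat \<Rightarrow> nat \<Rightarrow> ('m::{finite,linorder} ratfun, 'm frac_yh) module" where
  "frac_yh_algebra d n = extend_scalars to_fract (yh_algebra d n)"

definition frac_yh_elem :: "nat \<Rightarrow> nat \<Rightarrow> 'm::{finite,linorder} yh_free \<Rightarrow> 'm frac_yh" where
  "frac_yh_elem d n p =
    pure_tensor to_fract (yh_algebra d n) 1 (yh_ideal d n +>\<^bsub>yh_free_algebra n\<^esub> p)"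


section \<open>Representations\<close>

text \<open>
  The vector spaces considered are subspaces of the free vector space \<open>'b \<Rightarrow>\<^sub>0 'k\<close> on a type \<open>'b\<close>.
  An action \<open>\<rho>\<close> is only constrained on the carrier of the algebra and on the space.
\<close>

definition vscale :: "'k::field \<Rightarrow> ('b \<Rightarrow>\<^sub>0 'k) \<Rightarrow> ('b \<Rightarrow>\<^sub>0 'k)" where
  "vscale c = Poly_Mapping.map ((*) c)"

definition linear_on ::
    "('b \<Rightarrow>\<^sub>0 'k::field) set \<Rightarrow> ('c \<Rightarrow>\<^sub>0 'k) set \<Rightarrow> (('b \<Rightarrow>\<^sub>0 'k) \<Rightarrow> ('c \<Rightarrow>\<^sub>0 'k)) \<Rightarrow> bool" where
  "linear_on V W \<phi> \<longleftrightarrow> \<phi> \<in> V \<rightarrow> W \<and>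
    (\<forall>v\<in>V. \<forall>w\<in>V. \<phi> (v + w) = \<phi> v + \<phi> w) \<and> (\<forall>c. \<forall>v\<in>V. \<phi> (vscale c v) = vscale c (\<phi> v))"

definition representation ::
    "('k::field, 'a) module \<Rightarrow> ('b \<Rightarrow>\<^sub>0 'k) set \<Rightarrow> ('a \<Rightarrow> ('b \<Rightarrow>\<^sub>0 'k) \<Rightarrow> ('b \<Rightarrow>\<^sub>0 'k)) \<Rightarrow> bool" where
  "representation A V \<rho> \<longleftrightarrow> module.subspace vscale V \<and>
    (\<forall>a\<in>carrier A. linear_on V V (\<rho> a)) \<and>
    (\<forall>v\<in>V. \<rho> \<one>\<^bsub>A\<^esub> v = v) \<and>
    (\<forall>a\<in>carrier A. \<forall>b\<in>carrier A. \<forall>v\<in>V. \<rho> (a \<oplus>\<^bsub>A\<^esub> b) v = \<rho> a v + \<rho> b v) \<and>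
    (\<forall>a\<in>carrier A. \<forall>b\<in>carrier A. \<forall>v\<in>V. \<rho> (a \<otimes>\<^bsub>A\<^esub> b) v = \<rho> a (\<rho> b v)) \<and>
    (\<forall>c. \<forall>a\<in>carrier A. \<forall>v\<in>V. \<rho> (c \<odot>\<^bsub>A\<^esub> a) v = vscale c (\<rho> a v))"

definition irreducible_rep ::
    "('k::field, 'a) module \<Rightarrow> ('b \<Rightarrow>\<^sub>0 'k) set \<Rightarrow> ('a \<Rightarrow> ('b \<Rightarrow>\<^sub>0 'k) \<Rightarrow> ('b \<Rightarrow>\<^sub>0 'k)) \<Rightarrow> bool" where
  "irreducible_rep A V \<rho> \<longleftrightarrow> representation A V \<rho> \<and> V \<noteq> {0} \<and>
    (\<forall>W. module.subspace vscale W \<and> W \<subseteq> V \<and> (\<forall>a\<in>carrier A. \<rho> a ` W \<subseteq> W) \<longrightarrow>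
      W = {0} \<or> W = V)"

definition isomorphic_reps ::
    "('k::field, 'a) module \<Rightarrow> ('b \<Rightarrow>\<^sub>0 'k) set \<Rightarrow> ('a \<Rightarrow> ('b \<Rightarrow>\<^sub>0 'k) \<Rightarrow> ('b \<Rightarrow>\<^sub>0 'k)) \<Rightarrow>
      ('c \<Rightarrow>\<^sub>0 'k) set \<Rightarrow> ('a \<Rightarrow> ('c \<Rightarrow>\<^sub>0 'k) \<Rightarrow> ('c \<Rightarrow>\<^sub>0 'k)) \<Rightarrow> bool" where
  "isomorphic_reps A V \<rho> W \<sigma> \<longleftrightarrow>
    (\<exists>\<phi>. linear_on V W \<phi> \<and> bij_betw \<phi> V W \<and> (\<forall>a\<in>carrier A. \<forall>v\<in>V. \<phi> (\<rho> a v) = \<sigma> a (\<phi> v)))"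


section \<open>Multipartitions and tableaux\<close>

definition is_partition :: "nat list \<Rightarrow> bool" where
  "is_partition xs \<longleftrightarrow> sorted_wrt (\<ge>) xs \<and> 0 \<notin> set xs"

text \<open>Rows \<open>x\<close> and columns \<open>y\<close> are numbered from 1.\<close>

definition young_diagram :: "nat list \<Rightarrow> (nat \<times> nat) set" where
  "young_diagram xs = {(x, y). 1 \<le> x \<and> x \<le> length xs \<and> 1 \<le> y \<and> y \<le> xs ! (x - 1)}"

text \<open>\<open>\<Lambda> k l\<close> is the partition at position \<open>(k, l)\<close>.\<close>

definition multipartitions :: "nat \<Rightarrow> nat \<Rightarrow> (nat \<Rightarrow> 'm::finite \<Rightarrow> nat list) set" where
  "multipartitions d n = {\<Lambda> \<in> {1..d} \<rightarrow>\<^sub>E {f. \<forall>l. is_partition (f l)}.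
    (\<Sum>k\<in>{1..d}. \<Sum>l\<in>UNIV. sum_list (\<Lambda> k l)) = n}"

type_synonym 'm dm_node = "(nat \<times> nat) \<times> nat \<times> 'm"

definition dm_nodes :: "nat \<Rightarrow> (nat \<Rightarrow> 'm \<Rightarrow> nat list) \<Rightarrow> 'm dm_node set" where
  "dm_nodes d \<Lambda> = {(\<theta>, k, l). k \<in> {1..d} \<and> \<theta> \<in> young_diagram (\<Lambda> k l)}"

fun node_pos :: "'m dm_node \<Rightarrow> nat" where
  "node_pos ((x, y), k, l) = k"

fun node_content :: "'m::{finite,linorder} dm_node \<Rightarrow> 'm ratfun" where
  "node_content ((x, y), k, l) =
    to_fract (laurent_v l) * to_fract (laurent_q 1) powi (2 * (int y - int x))"

text \<open>A tableau \<open>T\<close> sends each entry \<open>i\<close> to the node containing it.\<close>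

type_synonym 'm dm_tableau = "nat \<Rightarrow> 'm dm_node"

definition dm_tableaux :: "nat \<Rightarrow> nat \<Rightarrow> (nat \<Rightarrow> 'm \<Rightarrow> nat list) \<Rightarrow> 'm dm_tableau set" where
  "dm_tableaux d n \<Lambda> = {T \<in> extensional {1..n}. bij_betw T {1..n} (dm_nodes d \<Lambda>)}"

definition standard_tableaux :: "nat \<Rightarrow> nat \<Rightarrow> (nat \<Rightarrow> 'm \<Rightarrow> nat list) \<Rightarrow> 'm dm_tableau set" where
  "standard_tableaux d n \<Lambda> = {T \<in> dm_tableaux d n \<Lambda>. \<forall>i\<in>{1..n}. \<forall>j\<in>{1..n}. \<forall>x y x' y' k l.
    T i = ((x, y), k, l) \<and> T j = ((x', y'), k, l) \<and> (x = x' \<and> y < y' \<or> y = y' \<and> x < x')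
      \<longrightarrow> i < j}"

definition tableau_perm :: "'m dm_tableau \<Rightarrow> (nat \<Rightarrow> nat) \<Rightarrow> 'm dm_tableau" where
  "tableau_perm T \<sigma> = T \<circ> inv_into UNIV \<sigma>"


section \<open>The representations \<open>V\<^sub>\<Lambda>\<close>\<close>

definition V_space ::
    "nat \<Rightarrow> nat \<Rightarrow> (nat \<Rightarrow> 'm \<Rightarrow> nat list) \<Rightarrow> ('m dm_tableau \<Rightarrow>\<^sub>0 'm::{finite,linorder} ratfun) set" where
  "V_space d n \<Lambda> = {v. Poly_Mapping.keys v \<subseteq> standard_tableaux d n \<Lambda>}"

definition V_vec ::
    "nat \<Rightarrow> nat \<Rightarrow> (nat \<Rightarrow> 'm \<Rightarrow> nat list) \<Rightarrow> 'm dm_tableau \<Rightarrow>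
      ('m dm_tableau \<Rightarrow>\<^sub>0 'm::{finite,linorder} ratfun)" where
  "V_vec d n \<Lambda> T = (if T \<in> standard_tableaux d n \<Lambda> then Poly_Mapping.single T 1 else 0)"

text \<open>
  \<open>\<rho>\<close> makes \<open>V_space d n \<Lambda>\<close> a representation of the algebra on which the generators act by the
  prescribed formulas.  On the space, this determines \<open>\<rho>\<close>, as the generators generate the algebra.
\<close>

definition V_action ::
    "nat \<Rightarrow> nat \<Rightarrow> (nat \<Rightarrow> complex) \<Rightarrow> (nat \<Rightarrow> 'm \<Rightarrow> nat list) \<Rightarrow>
      ('m frac_yh \<Rightarrow> ('m dm_tableau \<Rightarrow>\<^sub>0 'm ratfun) \<Rightarrow> ('m dm_tableau \<Rightarrow>\<^sub>0 'm::{finite,linorder} ratfun)) \<Rightarrow>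
      bool" where
  "V_action d n \<xi> \<Lambda> \<rho> \<longleftrightarrow>
    representation (frac_yh_algebra d n) (V_space d n \<Lambda>) \<rho> \<and>
    (\<forall>T \<in> standard_tableaux d n \<Lambda>.
      let p = (\<lambda>i. node_pos (T i)); c = (\<lambda>i. node_content (T i)); v = V_vec d n \<Lambda>;
          q = to_fract (laurent_q 1)
      in
        \<rho> (frac_yh_elem d n yh_X) (v T) = vscale (c 1) (v T) \<and>
        (\<forall>j. 1 \<le> j \<and> j \<le> n \<longrightarrow>
          \<rho> (frac_yh_elem d n (yh_t j)) (v T) = vscale (to_fract (laurent_const (\<xi> (p j)))) (v T)) \<and>
        (\<forall>i. 1 \<le> i \<and> i < n \<longrightarrow>
          \<rho> (frac_yh_elem d n (yh_g i)) (v T) =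
            (if p i \<noteq> p (i + 1) then v (tableau_perm T (transpose i (i + 1)))
             else vscale (c (i + 1) * (q - inverse q) / (c (i + 1) - c i)) (v T) +
                  vscale ((q * c (i + 1) - inverse q * c i) / (c (i + 1) - c i))
                    (v (tableau_perm T (transpose i (i + 1)))))))"

end

theory Submission
  imports Defs
begin

text \<open>
  The generators act on the free vector space on all tableaux by operators whose matrix coefficients
  depend only on the nodes containing \<open>i\<close> and \<open>i + 1\<close>. On a standard tableau three consecutive
  entries have pairwise different contents whenever they lie in the same component \<open>k\<close>, so the
  defining relations reduce to rational identities in the contents; this makes \<open>V\<^sub>\<Lambda>\<close> a
  module. The Jucys--Murphy elements \<open>X\<^sub>i\<^sub>+\<^sub>1 = g\<^sub>i X\<^sub>i g\<^sub>i\<close> and the \<open>t\<^sub>j\<close> act diagonally, with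
  eigenvalues that determine a standard tableau together with its shape. Hence a nonzero submodule
  contains some basis vector, and then all of them, since standard tableaux of one shape are
  connected by admissible transpositions of consecutive entries, along which the coefficients do
  not vanish. An isomorphism preserves the joint eigenvalues, and so the shape.
\<close>

section \<open>Linear extension\<close>

text \<open>The algebra is reached through three layers: noncommutative polynomials over Laurent
  polynomials, their quotient by the relators, and integer combinations of pairs modulo the tensor
  relators. Relations are therefore checked on words only, and the resulting action is pushed down
  the two quotients; a notion of action along a homomorphism \<open>h\<close> of scalars covers all
  layers, although the first two have scalars outside the field. The obstacle in the formulas is the
  convention that nonstandard tableaux stand for the zero vector. It is moved from the vectors into
  the coefficients, so that the span of the standard tableaux is stable inside a larger free space,
  and the point to verify is that the quadratic relation survives these zeros: it does because
  contents of adjacent nodes differ by the factor q^2. The eigenvalues do not show where on its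
  diagonal a node sits, so recovering the tableau is a combinatorial statement and not just a
  comparison of monomials. Irreducibility and non-isomorphism are proved for every action with the
  prescribed values on the generators; a separate existence statement keeps them from being
  empty.\<close>

lemma lookup_vscale [simp]: "Poly_Mapping.lookup (vscale c v) x = c * Poly_Mapping.lookup v x"
  by (simp add: vscale_def Poly_Mapping.map.rep_eq when_def)

interpretation vs: Modules.module "vscale :: 'k::field \<Rightarrow> ('b \<Rightarrow>\<^sub>0 'k) \<Rightarrow> ('b \<Rightarrow>\<^sub>0 'k)"
  by standard (auto intro!: poly_mapping_eqI simp: lookup_add algebra_simps)

lemma vscale_single [simp]: "vscale c (Poly_Mapping.single x r) = Poly_Mapping.single x (c * r)"
  by (auto intro!: poly_mapping_eqI simp: lookup_single when_def)

lemma keys_vscale_subset: "Poly_Mapping.keys (vscale c v) \<subseteq> Poly_Mapping.keys v"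
  by (auto simp: in_keys_iff)

lemma sum_single_lookup:
  fixes p :: "'a \<Rightarrow>\<^sub>0 'b::comm_monoid_add"
  shows "(\<Sum>x\<in>Poly_Mapping.keys p. Poly_Mapping.single x (Poly_Mapping.lookup p x)) = p"
proof (rule poly_mapping_eqI)
  fix y
  show "Poly_Mapping.lookup (\<Sum>x\<in>Poly_Mapping.keys p. Poly_Mapping.single x (Poly_Mapping.lookup p x)) y
      = Poly_Mapping.lookup p y"
    by (auto simp: lookup_sum lookup_single when_def sum.delta in_keys_iff)
qed

lemma basis_expansion:
  "v = (\<Sum>x\<in>Poly_Mapping.keys v. vscale (Poly_Mapping.lookup v x) (Poly_Mapping.single x 1))"
  by (simp add: sum_single_lookup)

lemma poly_mapping_single_add_induct [case_names zero add]:
  fixes p :: "'a \<Rightarrow>\<^sub>0 'b::comm_monoid_add"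
  assumes "P 0" and "\<And>x r p. P p \<Longrightarrow> P (Poly_Mapping.single x r + p)"
  shows "P p"
proof -
  have "P (\<Sum>x\<in>A. Poly_Mapping.single x (Poly_Mapping.lookup p x))" if "finite A" for A
    using that by induction (auto intro: assms)
  from this[of "Poly_Mapping.keys p"] show ?thesis
    by (simp add: sum_single_lookup)
qed

lemma linear_on_mem: "linear_on V W \<phi> \<Longrightarrow> v \<in> V \<Longrightarrow> \<phi> v \<in> W"
  and linear_on_add: "linear_on V W \<phi> \<Longrightarrow> v \<in> V \<Longrightarrow> w \<in> V \<Longrightarrow> \<phi> (v + w) = \<phi> v + \<phi> w"
  and linear_on_scale: "linear_on V W \<phi> \<Longrightarrow> v \<in> V \<Longrightarrow> \<phi> (vscale c v) = vscale c (\<phi> v)"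
  by (auto simp: linear_on_def)

lemma linear_on_0: "linear_on V W \<phi> \<Longrightarrow> 0 \<in> V \<Longrightarrow> \<phi> 0 = 0"
  using linear_on_scale[of V W \<phi> 0 0] by simp

lemma linear_on_sum:
  assumes "linear_on V W \<phi>" and "vs.subspace V" and "\<And>i. i \<in> A \<Longrightarrow> f i \<in> V"
  shows "\<phi> (sum f A) = (\<Sum>i\<in>A. \<phi> (f i))"
  using assms(3)
proof (induction A rule: infinite_finite_induct)
  case (insert i A)
  then show ?case
    using linear_on_add[OF assms(1), of "f i" "sum f A"] vs.subspace_sum[OF assms(2), of A f] by auto
qed (use linear_on_0[OF assms(1)] vs.subspace_0[OF assms(2)] in auto)

lemma linear_on_comp: "linear_on V W \<phi> \<Longrightarrow> linear_on U V \<psi> \<Longrightarrow> linear_on U W (\<lambda>v. \<phi> (\<psi> v))"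
  by (auto simp: linear_on_def Pi_iff)

text \<open>The map \<open>h\<close> on coefficients lets one construction serve three purposes:
  evaluation of polynomials with \<open>h = to_fract\<close>, integer combinations of tensors with
  \<open>h = of_int\<close>, and operators on the free space with the identity.\<close>

definition lin_ext ::
    "('r::zero \<Rightarrow> 'k::field) \<Rightarrow> ('x \<Rightarrow> ('b \<Rightarrow>\<^sub>0 'k)) \<Rightarrow> ('x \<Rightarrow>\<^sub>0 'r) \<Rightarrow> ('b \<Rightarrow>\<^sub>0 'k)" where
  "lin_ext h f p = (\<Sum>x\<in>Poly_Mapping.keys p. vscale (h (Poly_Mapping.lookup p x)) (f x))"

lemma lin_ext_superset:
  assumes "h 0 = 0" and "finite A" and "Poly_Mapping.keys p \<subseteq> A"
  shows "lin_ext h f p = (\<Sum>x\<in>A. vscale (h (Poly_Mapping.lookup p x)) (f x))"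
  unfolding lin_ext_def
  by (rule sum.mono_neutral_left) (use assms in \<open>auto simp: in_keys_iff\<close>)

lemma lin_ext_0 [simp]: "lin_ext h f 0 = 0"
  by (simp add: lin_ext_def)

lemma lin_ext_single: "h 0 = 0 \<Longrightarrow> lin_ext h f (Poly_Mapping.single x r) = vscale (h r) (f x)"
  by (cases "r = 0") (simp_all add: lin_ext_def)

lemma lin_ext_add:
  assumes "h 0 = 0" and "\<And>r s. h (r + s) = h r + h s"
  shows "lin_ext h f (p + q) = lin_ext h f p + lin_ext h f q"
proof -
  let ?A = "Poly_Mapping.keys p \<union> Poly_Mapping.keys q"
  have "Poly_Mapping.keys (p + q) \<subseteq> ?A"
    by (rule Poly_Mapping.keys_add)
  then have "lin_ext h f (p + q) = (\<Sum>x\<in>?A. vscale (h (Poly_Mapping.lookup (p + q) x)) (f x))"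
    by (intro lin_ext_superset assms(1)) auto
  also have "\<dots> = (\<Sum>x\<in>?A. vscale (h (Poly_Mapping.lookup p x)) (f x)) +
      (\<Sum>x\<in>?A. vscale (h (Poly_Mapping.lookup q x)) (f x))"
    by (simp add: lookup_add assms(2) vs.scale_left_distrib sum.distrib)
  also have "\<dots> = lin_ext h f p + lin_ext h f q"
    by (intro arg_cong2[of _ _ _ _ "(+)"] lin_ext_superset[symmetric] assms(1)) auto
  finally show ?thesis .
qed

lemma lin_ext_diff:
  fixes p q :: "'x \<Rightarrow>\<^sub>0 'r::ab_group_add"
  assumes "h 0 = 0" and "\<And>r s. h (r + s) = h r + h s"
  shows "lin_ext h f (p - q) = lin_ext h f p - lin_ext h f q"
  using lin_ext_add[OF assms, of f "p - q" q] by (simp add: algebra_simps)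

lemma lin_ext_sum:
  assumes "h 0 = 0" and "\<And>r s. h (r + s) = h r + h s"
  shows "lin_ext h f (sum p A) = (\<Sum>i\<in>A. lin_ext h f (p i))"
  by (induction A rule: infinite_finite_induct) (simp_all add: lin_ext_add[OF assms])

text \<open>Here \<open>p\<close> is fixed and linearity is in the vector \<open>v\<close>: this is
  how a fixed algebra element acts, as a combination of linear maps.\<close>

lemma lin_ext_linear_param:
  assumes "vs.subspace V" and "vs.subspace W"
    and "\<And>x. x \<in> Poly_Mapping.keys p \<Longrightarrow> linear_on V W (f x)"
  shows "linear_on V W (\<lambda>v. lin_ext h (\<lambda>x. f x v) p)"
  unfolding linear_on_def
proof (intro conjI ballI allI)
  show "(\<lambda>v. lin_ext h (\<lambda>x. f x v) p) \<in> V \<rightarrow> W"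
    unfolding lin_ext_def
    by (intro Pi_I vs.subspace_sum[OF assms(2)] vs.subspace_scale[OF assms(2)])
      (use assms(3) linear_on_mem in blast)
  show "lin_ext h (\<lambda>x. f x (v + w)) p = lin_ext h (\<lambda>x. f x v) p + lin_ext h (\<lambda>x. f x w) p"
    if "v \<in> V" "w \<in> V" for v w
    unfolding lin_ext_def sum.distrib[symmetric] using linear_on_add[OF assms(3)] that
    by (intro sum.cong) (auto simp: vs.scale_right_distrib)
  show "lin_ext h (\<lambda>x. f x (vscale c v)) p = vscale c (lin_ext h (\<lambda>x. f x v) p)"
    if "v \<in> V" for c v
    unfolding lin_ext_def vs.scale_sum_right using linear_on_scale[OF assms(3)] that
    by (intro sum.cong) (auto simp: mult.commute)
qed

lemma linear_on_lin_ext: "linear_on UNIV UNIV (lin_ext (\<lambda>c. c) f)"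
proof -
  have "lin_ext (\<lambda>c. c) f (vscale c v) = vscale c (lin_ext (\<lambda>c. c) f v)" for c v
    by (subst lin_ext_superset[where A = "Poly_Mapping.keys v"])
      (simp_all add: keys_vscale_subset lin_ext_def vs.scale_sum_right)
  then show ?thesis
    by (simp add: linear_on_def lin_ext_add)
qed


section \<open>Actions through a homomorphism of scalars\<close>

text \<open>This is \<open>representation\<close> with the scalars acting through \<open>h\<close>;
  the layers before the tensor product have Laurent polynomials as scalars but act on a space over
  the fraction field.\<close>

definition scalar_action ::
    "('r \<Rightarrow> 'k::field) \<Rightarrow> ('r, 'a) module \<Rightarrow> ('b \<Rightarrow>\<^sub>0 'k) set \<Rightarrow>
      ('a \<Rightarrow> ('b \<Rightarrow>\<^sub>0 'k) \<Rightarrow> ('b \<Rightarrow>\<^sub>0 'k)) \<Rightarrow> bool" where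
  "scalar_action h A V \<rho> \<longleftrightarrow> vs.subspace V \<and>
    (\<forall>a\<in>carrier A. linear_on V V (\<rho> a)) \<and>
    (\<forall>v\<in>V. \<rho> \<one>\<^bsub>A\<^esub> v = v) \<and>
    (\<forall>a\<in>carrier A. \<forall>b\<in>carrier A. \<forall>v\<in>V. \<rho> (a \<oplus>\<^bsub>A\<^esub> b) v = \<rho> a v + \<rho> b v) \<and>
    (\<forall>a\<in>carrier A. \<forall>b\<in>carrier A. \<forall>v\<in>V. \<rho> (a \<otimes>\<^bsub>A\<^esub> b) v = \<rho> a (\<rho> b v)) \<and>
    (\<forall>c. \<forall>a\<in>carrier A. \<forall>v\<in>V. \<rho> (c \<odot>\<^bsub>A\<^esub> a) v = vscale (h c) (\<rho> a v))"

lemma representation_iff: "representation A V \<rho> \<longleftrightarrow> scalar_action (\<lambda>c. c) A V \<rho>"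
  by (simp add: representation_def scalar_action_def)

text \<open>Closure under the operations is what the descent of an action to a quotient uses, so the
  descent applies to formal tensors without first establishing ring axioms for them.\<close>

definition algebra_closed :: "('r, 'a) module \<Rightarrow> bool" where
  "algebra_closed A \<longleftrightarrow> \<one>\<^bsub>A\<^esub> \<in> carrier A \<and>
    (\<forall>a\<in>carrier A. \<forall>b\<in>carrier A. a \<oplus>\<^bsub>A\<^esub> b \<in> carrier A \<and> a \<otimes>\<^bsub>A\<^esub> b \<in> carrier A) \<and>
    (\<forall>c. \<forall>a\<in>carrier A. c \<odot>\<^bsub>A\<^esub> a \<in> carrier A)"

lemma mem_a_r_coset: "y \<in> I +>\<^bsub>A\<^esub> x \<longleftrightarrow> (\<exists>i\<in>I. y = i \<oplus>\<^bsub>A\<^esub> x)"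
  by (auto simp: a_r_coset_def')

section \<open>Descent of an action to a quotient\<close>

lemma quotient_algebra_simps:
  "carrier (quotient_algebra A I) = (\<Union>x\<in>carrier A. {I +>\<^bsub>A\<^esub> x})"
  "\<one>\<^bsub>quotient_algebra A I\<^esub> = I +>\<^bsub>A\<^esub> \<one>\<^bsub>A\<^esub>"
  "C \<otimes>\<^bsub>quotient_algebra A I\<^esub> D = (\<Union>a\<in>C. \<Union>b\<in>D. I +>\<^bsub>A\<^esub> (a \<otimes>\<^bsub>A\<^esub> b))"
  "C \<oplus>\<^bsub>quotient_algebra A I\<^esub> D = (\<Union>a\<in>C. \<Union>b\<in>D. {a \<oplus>\<^bsub>A\<^esub> b})"
  "c \<odot>\<^bsub>quotient_algebra A I\<^esub> C = (\<Union>a\<in>C. I +>\<^bsub>A\<^esub> (c \<odot>\<^bsub>A\<^esub> a))"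
  by (simp_all add: quotient_algebra_def ring.defs module.defs FactRing_def A_RCOSETS_defs
      a_r_coset_def[symmetric] rcoset_mult_def set_add_def set_mult_def)

text \<open>A coset acts through a chosen representative; the choice is immaterial as soon as
  \<open>I\<close> acts by zero.\<close>

definition quotient_action :: "('a \<Rightarrow> 'v \<Rightarrow> 'w) \<Rightarrow> 'a set \<Rightarrow> 'v \<Rightarrow> 'w" where
  "quotient_action \<rho> C = \<rho> (SOME a. a \<in> C)"

context
  fixes h :: "'r \<Rightarrow> 'k::field" and A :: "('r, 'a) module" and V \<rho> I
  assumes act: "scalar_action h A V \<rho>" and closed: "algebra_closed A"
    and I: "I \<subseteq> carrier A" "I \<noteq> {}" and kill: "\<And>i v. i \<in> I \<Longrightarrow> v \<in> V \<Longrightarrow> \<rho> i v = 0"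
begin

lemma coset_action:
  assumes "x \<in> carrier A" "y \<in> I +>\<^bsub>A\<^esub> x"
  shows "y \<in> carrier A" and "v \<in> V \<Longrightarrow> \<rho> y v = \<rho> x v"
proof -
  obtain i where i: "i \<in> I" and y: "y = i \<oplus>\<^bsub>A\<^esub> x"
    using assms(2) by (auto simp: mem_a_r_coset)
  have iA: "i \<in> carrier A"
    using i I(1) by blast
  then show "y \<in> carrier A"
    using closed assms(1) unfolding y algebra_closed_def by blast
  show "\<rho> y v = \<rho> x v" if "v \<in> V"
    using act iA assms(1) kill[OF i that] that unfolding y scalar_action_def by simp
qed

text \<open>Products and scalar multiples of cosets are unions over representatives. It suffices
  that all elements of such a union act alike on \<open>v\<close>, which avoids identifying the
  union with a single coset.\<close>

lemma quotient_action_eqI: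
  assumes "C \<noteq> {}" and "\<And>y. y \<in> C \<Longrightarrow> \<rho> y v = w"
  shows "quotient_action \<rho> C v = w"
  unfolding quotient_action_def using assms some_in_eq by metis

lemma coset_nonempty: "I +>\<^bsub>A\<^esub> x \<noteq> {}"
  using I(2) by (auto simp: a_r_coset_def')

lemma quotient_action_coset:
  assumes "x \<in> carrier A" "v \<in> V"
  shows "quotient_action \<rho> (I +>\<^bsub>A\<^esub> x) v = \<rho> x v"
  using coset_nonempty coset_action(2)[OF assms(1) _ assms(2)] by (rule quotient_action_eqI)

lemma scalar_action_quotient: "scalar_action h (quotient_algebra A I) V (quotient_action \<rho>)"
proof -
  have V: "vs.subspace V" and lin: "\<And>a. a \<in> carrier A \<Longrightarrow> linear_on V V (\<rho> a)"
    and one: "\<And>v. v \<in> V \<Longrightarrow> \<rho> \<one>\<^bsub>A\<^esub> v = v"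
    and add: "\<And>a b v. a \<in> carrier A \<Longrightarrow> b \<in> carrier A \<Longrightarrow> v \<in> V \<Longrightarrow> \<rho> (a \<oplus>\<^bsub>A\<^esub> b) v = \<rho> a v + \<rho> b v"
    and mult: "\<And>a b v. a \<in> carrier A \<Longrightarrow> b \<in> carrier A \<Longrightarrow> v \<in> V \<Longrightarrow> \<rho> (a \<otimes>\<^bsub>A\<^esub> b) v = \<rho> a (\<rho> b v)"
    and smult: "\<And>c a v. a \<in> carrier A \<Longrightarrow> v \<in> V \<Longrightarrow> \<rho> (c \<odot>\<^bsub>A\<^esub> a) v = vscale (h c) (\<rho> a v)"
    using act by (auto simp: scalar_action_def)
  have cl: "\<one>\<^bsub>A\<^esub> \<in> carrier A" "\<And>a b. a \<in> carrier A \<Longrightarrow> b \<in> carrier A \<Longrightarrow> a \<otimes>\<^bsub>A\<^esub> b \<in> carrier A"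
    "\<And>c a. a \<in> carrier A \<Longrightarrow> c \<odot>\<^bsub>A\<^esub> a \<in> carrier A"
    using closed by (auto simp: algebra_closed_def)
  have mem: "\<rho> a v \<in> V" if "a \<in> carrier A" "v \<in> V" for a v
    using lin linear_on_mem that by blast
  note ca = coset_action(1) coset_action(2)
  show ?thesis
    unfolding scalar_action_def
  proof (intro conjI ballI allI V)
    fix C assume "C \<in> carrier (quotient_algebra A I)"
    then obtain x where x: "x \<in> carrier A" and C: "C = I +>\<^bsub>A\<^esub> x"
      by (auto simp: quotient_algebra_simps)
    show "linear_on V V (quotient_action \<rho> C)"
      using lin[OF x] V vs.subspace_add[OF V] vs.subspace_scale[OF V] unfolding C
      by (auto simp: linear_on_def Pi_iff quotient_action_coset[OF x])
    show "quotient_action \<rho> (c \<odot>\<^bsub>quotient_algebra A I\<^esub> C) v = vscale (h c) (quotient_action \<rho> C v)"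
      if v: "v \<in> V" for c v
    proof (rule quotient_action_eqI)
      show "c \<odot>\<^bsub>quotient_algebra A I\<^esub> C \<noteq> {}"
        unfolding C quotient_algebra_simps by (simp add: coset_nonempty)
      fix y assume "y \<in> c \<odot>\<^bsub>quotient_algebra A I\<^esub> C"
      then obtain a where a: "a \<in> C" and y: "y \<in> I +>\<^bsub>A\<^esub> (c \<odot>\<^bsub>A\<^esub> a)"
        by (auto simp: quotient_algebra_simps)
      have "a \<in> carrier A" "\<rho> a v = \<rho> x v"
        using ca[OF x a[unfolded C]] v by auto
      then show "\<rho> y v = vscale (h c) (quotient_action \<rho> C v)"
        unfolding C quotient_action_coset[OF x v]
        by (simp add: ca(2)[OF _ y v] cl smult v)
    qed
    fix D assume "D \<in> carrier (quotient_algebra A I)"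
    then obtain z where z: "z \<in> carrier A" and D: "D = I +>\<^bsub>A\<^esub> z"
      by (auto simp: quotient_algebra_simps)
    fix v assume v: "v \<in> V"
    show "quotient_action \<rho> (C \<oplus>\<^bsub>quotient_algebra A I\<^esub> D) v
        = quotient_action \<rho> C v + quotient_action \<rho> D v"
    proof (rule quotient_action_eqI)
      show "C \<oplus>\<^bsub>quotient_algebra A I\<^esub> D \<noteq> {}"
        unfolding C D quotient_algebra_simps by (simp add: coset_nonempty)
      fix y assume "y \<in> C \<oplus>\<^bsub>quotient_algebra A I\<^esub> D"
      then obtain a b where a: "a \<in> C" and b: "b \<in> D" and y: "y = a \<oplus>\<^bsub>A\<^esub> b"
        by (auto simp: quotient_algebra_simps)
      show "\<rho> y v = quotient_action \<rho> C v + quotient_action \<rho> D v"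
        unfolding C D y quotient_action_coset[OF x v] quotient_action_coset[OF z v]
        using ca[OF x a[unfolded C]] ca[OF z b[unfolded D]] add v by simp
    qed
    show "quotient_action \<rho> (C \<otimes>\<^bsub>quotient_algebra A I\<^esub> D) v
        = quotient_action \<rho> C (quotient_action \<rho> D v)"
    proof (rule quotient_action_eqI)
      show "C \<otimes>\<^bsub>quotient_algebra A I\<^esub> D \<noteq> {}"
        unfolding C D quotient_algebra_simps by (simp add: coset_nonempty)
      fix y assume "y \<in> C \<otimes>\<^bsub>quotient_algebra A I\<^esub> D"
      then obtain a b where a: "a \<in> C" and b: "b \<in> D" and y: "y \<in> I +>\<^bsub>A\<^esub> (a \<otimes>\<^bsub>A\<^esub> b)"
        by (auto simp: quotient_algebra_simps)
      show "\<rho> y v = quotient_action \<rho> C (quotient_action \<rho> D v)"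
        unfolding C D quotient_action_coset[OF z v] quotient_action_coset[OF x mem[OF z v]]
        using ca[OF x a[unfolded C]] ca[OF z b[unfolded D]] ca(2)[OF cl(2) y v] mult v mem[OF z v]
        by simp
    qed
  next
    fix v assume "v \<in> V"
    then show "quotient_action \<rho> \<one>\<^bsub>quotient_algebra A I\<^esub> v = v"
      by (simp add: quotient_algebra_simps quotient_action_coset cl one)
  qed
qed

end


section \<open>Evaluation of noncommutative polynomials\<close>

lemma free_algebra_closed: "algebra_closed (free_algebra S :: ('r::comm_ring_1, 'x free_monoid \<Rightarrow>\<^sub>0 'r) module)"
proof -
  interpret ring "free_algebra S :: ('r, 'x free_monoid \<Rightarrow>\<^sub>0 'r) module"
    by (rule free_algebra_ring)
  have "scalar r \<in> carrier (free_algebra S :: ('r, 'x free_monoid \<Rightarrow>\<^sub>0 'r) module)" for r :: 'r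
    by (simp add: free_algebra_def zero_free_monoid_def)
  moreover have "r \<odot>\<^bsub>free_algebra S\<^esub> p = scalar r \<otimes>\<^bsub>free_algebra S\<^esub> p"
    for r :: 'r and p :: "'x free_monoid \<Rightarrow>\<^sub>0 'r"
    by (simp add: free_algebra_def)
  ultimately show ?thesis
    by (simp add: algebra_closed_def)
qed

text \<open>With \<open>foldr\<close> the last letter of a word acts first, so concatenation of
  words becomes composition of operators.\<close>

definition free_eval ::
    "('r::zero \<Rightarrow> 'k::field) \<Rightarrow> ('x \<Rightarrow> ('b \<Rightarrow>\<^sub>0 'k) \<Rightarrow> ('b \<Rightarrow>\<^sub>0 'k)) \<Rightarrow> ('x free_monoid \<Rightarrow>\<^sub>0 'r) \<Rightarrow>
      ('b \<Rightarrow>\<^sub>0 'k) \<Rightarrow> ('b \<Rightarrow>\<^sub>0 'k)" where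
  "free_eval h \<alpha> p v = lin_ext h (\<lambda>w. foldr \<alpha> (letters w) v) p"

locale free_evaluation =
  fixes h :: "'r::comm_ring_1 \<Rightarrow> 'k::field"
    and \<alpha> :: "'x \<Rightarrow> ('b \<Rightarrow>\<^sub>0 'k) \<Rightarrow> ('b \<Rightarrow>\<^sub>0 'k)"
  assumes hom_0: "h 0 = 0" and hom_1: "h 1 = 1"
    and hom_add: "h (r + s) = h r + h s" and hom_mult: "h (r * s) = h r * h s"
    and linear: "linear_on UNIV UNIV (\<alpha> x)"
begin

abbreviation "ev \<equiv> free_eval h \<alpha>"

lemma linear_word: "linear_on UNIV UNIV (foldr \<alpha> xs)"
proof (induction xs)
  case (Cons x xs)
  show ?case
    using linear_on_comp[OF linear Cons] by (simp add: comp_def)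
qed (simp add: linear_on_def)

lemma linear_ev: "linear_on UNIV UNIV (ev p)"
proof -
  have "linear_on UNIV UNIV (\<lambda>v. lin_ext h (\<lambda>w. foldr \<alpha> (letters w) v) p)"
    by (rule lin_ext_linear_param) (simp_all add: linear_word)
  then show ?thesis
    by (simp add: free_eval_def[abs_def])
qed

lemma ev_0 [simp]: "ev 0 v = 0"
  by (simp add: free_eval_def)

lemma ev_add: "ev (p + q) v = ev p v + ev q v"
  by (simp add: free_eval_def lin_ext_add hom_0 hom_add)

lemma ev_diff: "ev (p - q) v = ev p v - ev q v"
  by (simp add: free_eval_def lin_ext_diff hom_0 hom_add)

lemma ev_sum: "ev (sum p A) v = (\<Sum>i\<in>A. ev (p i) v)"
  by (simp add: free_eval_def lin_ext_sum hom_0 hom_add)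

lemma ev_single: "ev (Poly_Mapping.single w r) v = vscale (h r) (foldr \<alpha> (letters w) v)"
  by (simp add: free_eval_def lin_ext_single hom_0)

lemma ev_letter: "ev (letter x) v = \<alpha> x v"
  by (simp add: ev_single hom_1)

lemma ev_scalar: "ev (scalar r) v = vscale (h r) v"
  by (simp add: ev_single zero_free_monoid_def)

lemma ev_1: "ev 1 v = v"
  using ev_scalar[of 1] by (simp add: hom_1)

lemmas ev_plus = linear_on_add[OF linear_ev UNIV_I UNIV_I]
  and ev_scale = linear_on_scale[OF linear_ev UNIV_I]

text \<open>Both factors are split into monomials. For two monomials, the coefficient of the right
  one is moved past the word of the left one by linearity of that word.\<close>

lemma ev_mult: "ev (p * q) v = ev p (ev q v)"
proof (induction p rule: poly_mapping_single_add_induct)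
  case zero
  show ?case by simp
next
  case (add x r p)
  have "ev (Poly_Mapping.single x r * q) v = ev (Poly_Mapping.single x r) (ev q v)"
  proof (induction q rule: poly_mapping_single_add_induct)
    case zero
    show ?case
      using linear_on_0[OF linear_ev] by simp
  next
    case (add y s q)
    have "ev (Poly_Mapping.single x r * Poly_Mapping.single y s) v
        = ev (Poly_Mapping.single x r) (ev (Poly_Mapping.single y s) v)"
      by (simp add: mult_single ev_single plus_free_monoid_def hom_mult
          linear_on_scale[OF linear_word])
    then show ?case
      by (simp add: distrib_left ev_add ev_plus add)
  qed
  then show ?case
    by (simp add: distrib_right ev_add add)
qed

lemma ev_power: "ev (p ^ k) v = (ev p ^^ k) v"
  by (induction k arbitrary: v) (simp_all add: ev_1 ev_mult)

lemma ev_invariant: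
  assumes "vs.subspace V" and "\<And>x v. v \<in> V \<Longrightarrow> \<alpha> x v \<in> V" and "v \<in> V"
  shows "ev p v \<in> V"
proof -
  have "foldr \<alpha> xs v \<in> V" for xs
    using assms by (induction xs) auto
  then show ?thesis
    unfolding free_eval_def lin_ext_def
    by (intro vs.subspace_sum vs.subspace_scale assms)
qed

lemma scalar_action_free:
  assumes "vs.subspace V" and "\<And>x v. v \<in> V \<Longrightarrow> \<alpha> x v \<in> V"
  shows "scalar_action h (free_algebra S) V ev"
  unfolding scalar_action_def
  by (auto simp: assms linear_on_def ev_invariant free_algebra_def ev_1 ev_add ev_mult ev_scalar
      ev_plus ev_scale)

text \<open>Since \<open>Idl\<close> is the smallest ideal containing the relators, this reduces the
  vanishing of a whole ideal to that of its generators. Stability of \<open>V\<close> enters for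
  right multiples: \<open>a * x\<close> kills \<open>v\<close> because \<open>a\<close> kills
  \<open>ev x v\<close>.\<close>

lemma killing_ideal:
  assumes "vs.subspace V" and "\<And>x v. v \<in> V \<Longrightarrow> \<alpha> x v \<in> V"
  shows "ideal {p \<in> carrier (free_algebra S). \<forall>v\<in>V. ev p v = 0}
    (free_algebra S :: ('r, 'x free_monoid \<Rightarrow>\<^sub>0 'r) module)" (is "ideal ?K ?A")
proof -
  interpret R: ring ?A
    by (rule free_algebra_ring)
  have s: "a \<oplus>\<^bsub>?A\<^esub> b = a + b" "a \<otimes>\<^bsub>?A\<^esub> b = a * b" "\<zero>\<^bsub>?A\<^esub> = 0" for a b
    by (simp_all add: free_algebra_def)
  have inv: "\<ominus>\<^bsub>?A\<^esub> a = - a" if "a \<in> carrier ?A" for a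
    using R.r_neg[OF that] unfolding s by (simp add: eq_neg_iff_add_eq_0 add.commute)
  have neg: "ev (- a) v = - ev a v" for a v
    using ev_diff[of 0 a v] by simp
  show ?thesis
  proof (rule idealI[OF free_algebra_ring])
    show "subgroup ?K (add_monoid ?A)"
    proof (rule R.add.subgroupI)
      show "?K \<noteq> {}"
        using R.zero_closed by (auto simp: s)
      show "\<ominus>\<^bsub>?A\<^esub> a \<in> ?K" if "a \<in> ?K" for a
        using that R.a_inv_closed[of a] inv[of a] neg[of a] by auto
      show "a \<oplus>\<^bsub>?A\<^esub> b \<in> ?K" if "a \<in> ?K" "b \<in> ?K" for a b
        using that R.a_closed[of a b] by (auto simp: s ev_add)
    qed auto
  next
    fix a x assume a: "a \<in> ?K" and x: "x \<in> carrier ?A"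
    show "x \<otimes>\<^bsub>?A\<^esub> a \<in> ?K"
      using a x R.m_closed[of x a] linear_on_0[OF linear_ev] by (auto simp: s ev_mult)
    show "a \<otimes>\<^bsub>?A\<^esub> x \<in> ?K"
      using a x R.m_closed[of a x] ev_invariant[OF assms] by (auto simp: s ev_mult)
  qed
qed

end


section \<open>Extension of scalars\<close>

text \<open>The ring operations are those of \<open>Quot\<close>. Multiplication by \<open>c\<close>
  is multiplication by the element \<open>scalar c\<close>, so changing the representative changes
  the result by an element of the ideal, and the union defining the scalar multiple collapses to one
  coset.\<close>

lemma quotient_free_closed:
  assumes "ideal I (free_algebra S :: ('r::comm_ring_1, 'x free_monoid \<Rightarrow>\<^sub>0 'r) module)"
  shows "algebra_closed (quotient_algebra (free_algebra S :: ('r, 'x free_monoid \<Rightarrow>\<^sub>0 'r) module) I)"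
    (is "algebra_closed (quotient_algebra ?A I)")
proof -
  interpret ideal I ?A by fact
  have Q: "carrier (quotient_algebra ?A I) = carrier (?A Quot I)"
    "\<And>C D. C \<otimes>\<^bsub>quotient_algebra ?A I\<^esub> D = C \<otimes>\<^bsub>?A Quot I\<^esub> D"
    "\<And>C D. C \<oplus>\<^bsub>quotient_algebra ?A I\<^esub> D = C \<oplus>\<^bsub>?A Quot I\<^esub> D"
    "\<one>\<^bsub>quotient_algebra ?A I\<^esub> = \<one>\<^bsub>?A Quot I\<^esub>"
    by (simp_all add: quotient_algebra_def ring.defs)
  interpret Q: ring "?A Quot I"
    by (rule quotient_is_ring)
  have "c \<odot>\<^bsub>quotient_algebra ?A I\<^esub> C \<in> carrier (quotient_algebra ?A I)"
    if mem: "C \<in> carrier (quotient_algebra ?A I)" for c C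
  proof -
    obtain x where x: "x \<in> carrier ?A" and C: "C = I +>\<^bsub>?A\<^esub> x"
      using mem by (auto simp: quotient_algebra_simps)
    have sc: "scalar c \<in> carrier ?A"
      by (simp add: free_algebra_def zero_free_monoid_def)
    have smult: "c \<odot>\<^bsub>?A\<^esub> p = scalar c \<otimes>\<^bsub>?A\<^esub> p" for p
      by (simp add: free_algebra_def)
    have "I +>\<^bsub>?A\<^esub> (c \<odot>\<^bsub>?A\<^esub> a) = I +>\<^bsub>?A\<^esub> (scalar c \<otimes>\<^bsub>?A\<^esub> x)" if a: "a \<in> C" for a
    proof -
      obtain i where i: "i \<in> I" "a = i \<oplus>\<^bsub>?A\<^esub> x"
        using a unfolding C mem_a_r_coset by auto
      have "scalar c \<otimes>\<^bsub>?A\<^esub> a = scalar c \<otimes>\<^bsub>?A\<^esub> i \<oplus>\<^bsub>?A\<^esub> scalar c \<otimes>\<^bsub>?A\<^esub> x"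
        unfolding i(2) using r_distr sc x a_Hcarr[OF i(1)] by blast
      then have "c \<odot>\<^bsub>?A\<^esub> a \<in> I +>\<^bsub>?A\<^esub> (scalar c \<otimes>\<^bsub>?A\<^esub> x)"
        unfolding mem_a_r_coset smult using I_l_closed[OF i(1) sc] by blast
      from a_repr_independence'[OF this] show ?thesis
        using m_closed[OF sc x] by simp
    qed
    moreover have "C \<noteq> {}"
      unfolding C using a_rcos_self[OF x] by blast
    ultimately have "c \<odot>\<^bsub>quotient_algebra ?A I\<^esub> C = I +>\<^bsub>?A\<^esub> (scalar c \<otimes>\<^bsub>?A\<^esub> x)"
      unfolding quotient_algebra_simps by auto
    then show ?thesis
      using m_closed[OF sc x] by (auto simp: quotient_algebra_simps(1))
  qed
  then show ?thesis
    unfolding algebra_closed_def Q by simp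
qed

definition tensor_action ::
    "('a \<Rightarrow> ('b \<Rightarrow>\<^sub>0 'k) \<Rightarrow> ('b \<Rightarrow>\<^sub>0 'k)) \<Rightarrow> (('k::field \<times> 'a) \<Rightarrow>\<^sub>0 int) \<Rightarrow>
      ('b \<Rightarrow>\<^sub>0 'k) \<Rightarrow> ('b \<Rightarrow>\<^sub>0 'k)" where
  "tensor_action \<rho> x v = lin_ext of_int (\<lambda>y. vscale (fst y) (\<rho> (snd y) v)) x"

lemma tensor_action_frag_of [simp]: "tensor_action \<rho> (frag_of (c, a)) v = vscale c (\<rho> a v)"
  by (simp add: tensor_action_def lin_ext_single)

lemma tensor_action_add: "tensor_action \<rho> (x + y) v = tensor_action \<rho> x v + tensor_action \<rho> y v"
  by (simp add: tensor_action_def lin_ext_add)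

lemma tensor_action_diff: "tensor_action \<rho> (x - y) v = tensor_action \<rho> x v - tensor_action \<rho> y v"
  by (simp add: tensor_action_def lin_ext_diff)

lemma formal_tensors_simps:
  "carrier (formal_tensors A) = {x. Poly_Mapping.keys x \<subseteq> UNIV \<times> carrier A}"
  "\<one>\<^bsub>formal_tensors A\<^esub> = frag_of (1, \<one>\<^bsub>A\<^esub>)"
  "x \<oplus>\<^bsub>formal_tensors A\<^esub> y = x + y"
  "x \<otimes>\<^bsub>formal_tensors A\<^esub> y = frag_extend
       (\<lambda>(f, a). frag_extend (\<lambda>(g, b). frag_of (f * g, a \<otimes>\<^bsub>A\<^esub> b)) y) x"
  "f \<odot>\<^bsub>formal_tensors A\<^esub> x = frag_extend (\<lambda>(g, a). frag_of (f * g, a)) x"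
  by (simp_all add: formal_tensors_def free_Abelian_group_def)

lemma formal_tensors_closed:
  assumes "algebra_closed A"
  shows "algebra_closed (formal_tensors A)"
  unfolding algebra_closed_def formal_tensors_simps mem_Collect_eq
proof (intro conjI ballI allI subsetI, goal_cases)
  case (1 z)
  then show ?case
    using assms by (auto simp: algebra_closed_def)
next
  case (2 x y z)
  then show ?case
    using Poly_Mapping.keys_add[of x y] by blast
next
  case (3 x y z)
  from 3(3) obtain s where s: "s \<in> Poly_Mapping.keys x" and z: "z \<in> Poly_Mapping.keys
      (frag_extend (\<lambda>(g, b). frag_of (fst s * g, snd s \<otimes>\<^bsub>A\<^esub> b)) y)"
    using keys_frag_extend by (fastforce simp: case_prod_unfold)
  from z obtain t where t: "t \<in> Poly_Mapping.keys y" and z: "z = (fst s * fst t, snd s \<otimes>\<^bsub>A\<^esub> snd t)"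
    using keys_frag_extend by (fastforce simp: case_prod_unfold)
  have "snd s \<in> carrier A" "snd t \<in> carrier A"
    using s t 3(1,2) by auto
  then show ?case
    using assms unfolding z algebra_closed_def by simp
next
  case (4 c x z)
  from 4(2) obtain t where t: "t \<in> Poly_Mapping.keys x" and z: "z = (c * fst t, snd t)"
    using keys_frag_extend by (fastforce simp: case_prod_unfold)
  then show ?case
    using 4(1) by auto
qed

text \<open>Scalars commute with the linear maps \<open>\<rho> a\<close>, so a product of pairs acts
  as the composite, and expansion in both arguments does the rest. The scalars of formal tensors
  already lie in the field, so the conclusion has the identity in place of \<open>h\<close>;
  \<open>h\<close> returns with the relators.\<close>

lemma scalar_action_tensor:
  fixes A :: "('r, 'a) module" and V :: "('b \<Rightarrow>\<^sub>0 'k::field) set"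
  assumes "scalar_action h A V \<rho>"
  shows "scalar_action (\<lambda>c. c) (formal_tensors A) V (tensor_action \<rho>)"
proof -
  have V: "vs.subspace V" and lin: "\<And>a. a \<in> carrier A \<Longrightarrow> linear_on V V (\<rho> a)"
    and one: "\<And>v. v \<in> V \<Longrightarrow> \<rho> \<one>\<^bsub>A\<^esub> v = v"
    and mult: "\<And>a b v. a \<in> carrier A \<Longrightarrow> b \<in> carrier A \<Longrightarrow> v \<in> V \<Longrightarrow> \<rho> (a \<otimes>\<^bsub>A\<^esub> b) v = \<rho> a (\<rho> b v)"
    using assms by (auto simp: scalar_action_def)
  have mem: "\<rho> a v \<in> V" if "a \<in> carrier A" "v \<in> V" for a v
    using lin linear_on_mem that by blast
  have linear_pure: "linear_on V V (\<lambda>v. vscale c (\<rho> a v))" if "a \<in> carrier A" for a c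
    using lin[OF that] vs.subspace_scale[OF V]
    by (auto simp: linear_on_def Pi_iff vs.scale_right_distrib mult.commute)
  have linear: "linear_on V V (tensor_action \<rho> x)" if "x \<in> carrier (formal_tensors A)" for x
    unfolding tensor_action_def
    by (rule lin_ext_linear_param[OF V V]) (use that linear_pure in \<open>auto simp: formal_tensors_simps\<close>)
  have extend: "tensor_action \<rho> (frag_extend f x) v =
      (\<Sum>y\<in>Poly_Mapping.keys x. vscale (of_int (Poly_Mapping.lookup x y)) (tensor_action \<rho> (f y) v))"
    for f :: "'k \<times> 'a \<Rightarrow> _" and x v
  proof -
    have "tensor_action \<rho> (frag_cmul c y) v = vscale (of_int c) (tensor_action \<rho> y v)" for c y
      \<comment> \<open>For nonzero \<open>c\<close> the multiple has the same support as
        \<open>y\<close>, so both sums run over the same keys.\<close>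
      by (cases "c = 0")
        (simp_all add: tensor_action_def lin_ext_def vs.scale_sum_right mult.assoc
          Poly_Mapping.keys.rep_eq)
    then show ?thesis
      unfolding frag_extend_def by (simp add: tensor_action_def lin_ext_sum)
  qed
  show ?thesis
    unfolding scalar_action_def
  proof (intro conjI ballI allI V linear)
    show "tensor_action \<rho> \<one>\<^bsub>formal_tensors A\<^esub> v = v" if "v \<in> V" for v
      by (simp add: formal_tensors_simps one that)
    show "tensor_action \<rho> (x \<oplus>\<^bsub>formal_tensors A\<^esub> y) v = tensor_action \<rho> x v + tensor_action \<rho> y v" for x y v
      by (simp add: formal_tensors_simps tensor_action_add)
    show "tensor_action \<rho> (x \<otimes>\<^bsub>formal_tensors A\<^esub> y) v = tensor_action \<rho> x (tensor_action \<rho> y v)"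
      if x: "x \<in> carrier (formal_tensors A)" and y: "y \<in> carrier (formal_tensors A)" and v: "v \<in> V" for x y v
    proof -
      have *: "vscale c (\<rho> a (tensor_action \<rho> y v))
          = tensor_action \<rho> (frag_extend (\<lambda>(g, b). frag_of (c * g, a \<otimes>\<^bsub>A\<^esub> b)) y) v"
        if a: "a \<in> carrier A" for c a
      proof -
        have yk: "snd z \<in> carrier A" if "z \<in> Poly_Mapping.keys y" for z
          using y that by (auto simp: formal_tensors_simps)
        have "vscale c (\<rho> a (tensor_action \<rho> y v)) = vscale c (\<Sum>z\<in>Poly_Mapping.keys y.
            \<rho> a (vscale (of_int (Poly_Mapping.lookup y z)) (vscale (fst z) (\<rho> (snd z) v))))"
          unfolding tensor_action_def lin_ext_def
          by (subst linear_on_sum[OF lin[OF a] V])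
            (use yk v mem vs.subspace_scale[OF V] in auto)
        also have "\<dots> = (\<Sum>z\<in>Poly_Mapping.keys y. vscale (of_int (Poly_Mapping.lookup y z))
            (tensor_action \<rho> (frag_of (c * fst z, a \<otimes>\<^bsub>A\<^esub> snd z)) v))"
          unfolding vs.scale_sum_right
          by (intro sum.cong refl)
            (use yk a v mem linear_on_scale[OF lin[OF a]] vs.subspace_scale[OF V]
              in \<open>auto simp: mult ac_simps\<close>)
        also have "\<dots> = tensor_action \<rho> (frag_extend (\<lambda>(g, b). frag_of (c * g, a \<otimes>\<^bsub>A\<^esub> b)) y) v"
          by (simp add: extend case_prod_unfold)
        finally show ?thesis .
      qed
      have "tensor_action \<rho> x (tensor_action \<rho> y v) = (\<Sum>z\<in>Poly_Mapping.keys x.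
          vscale (of_int (Poly_Mapping.lookup x z)) (vscale (fst z) (\<rho> (snd z) (tensor_action \<rho> y v))))"
        by (simp add: tensor_action_def[of _ x] lin_ext_def)
      also have "\<dots> = tensor_action \<rho> (x \<otimes>\<^bsub>formal_tensors A\<^esub> y) v"
        unfolding formal_tensors_simps extend[where x = x]
      proof (intro sum.cong refl arg_cong[of _ _ "vscale _"])
        fix z assume "z \<in> Poly_Mapping.keys x"
        then have "snd z \<in> carrier A"
          using x by (auto simp: formal_tensors_simps)
        from *[OF this, of "fst z"]
        show "vscale (fst z) (\<rho> (snd z) (tensor_action \<rho> y v)) = tensor_action \<rho>
            (case z of (f, a) \<Rightarrow> frag_extend (\<lambda>(g, b). frag_of (f * g, a \<otimes>\<^bsub>A\<^esub> b)) y) v"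
          by (simp add: case_prod_unfold)
      qed
      finally show ?thesis
        by simp
    qed
    show "tensor_action \<rho> (c \<odot>\<^bsub>formal_tensors A\<^esub> x) v = vscale c (tensor_action \<rho> x v)" for c x v
      unfolding formal_tensors_simps extend
      by (auto simp: tensor_action_def[of _ x] lin_ext_def vs.scale_sum_right ac_simps intro!: sum.cong)
  qed
qed

text \<open>The first two kinds of relators act by zero by additivity in each argument, the third
  because \<open>r\<close> acts through \<open>h r\<close>; induction over \<open>generate\<close>
  carries this to the subgroup.\<close>

lemma tensor_subgroup_kills:
  fixes h :: "'r \<Rightarrow> 'k::field" and A :: "('r, 'a) module"
  assumes act: "scalar_action h A V \<rho>" and closed: "algebra_closed A" and x: "x \<in> tensor_subgroup h A"
  shows "x \<in> carrier (formal_tensors A)" and "v \<in> V \<Longrightarrow> tensor_action \<rho> x v = 0"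
proof -
  let ?G = "free_Abelian_group ((UNIV :: 'k set) \<times> carrier A)"
  have rel: "x \<in> carrier ?G \<and> (\<forall>v\<in>V. tensor_action \<rho> x v = 0)" if "x \<in> tensor_relators h A" for x
    using that closed act unfolding tensor_relators_def
    by (auto simp: algebra_closed_def scalar_action_def tensor_action_diff vs.scale_right_distrib
        vs.scale_left_distrib dest!: subsetD[OF keys_diff])
  have "x \<in> carrier ?G \<and> (\<forall>v\<in>V. tensor_action \<rho> x v = 0)"
    using x unfolding tensor_subgroup_def
  proof induction
    case one
    show ?case by (simp add: tensor_action_def)
  next
    case (incl x)
    then show ?case using rel by blast
  next
    case (inv x)
    have "tensor_action \<rho> (- x) v = - tensor_action \<rho> x v" for v
      using tensor_action_diff[of \<rho> 0 x v] by (simp add: tensor_action_def)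
    then show ?case
      using rel[OF inv] by simp
  next
    case (eng x y)
    then show ?case
      using Poly_Mapping.keys_add[of x y] by (auto simp: tensor_action_add)
  qed
  then show "x \<in> carrier (formal_tensors A)" "v \<in> V \<Longrightarrow> tensor_action \<rho> x v = 0"
    by (auto simp: formal_tensors_simps)
qed

lemma representation_extend_scalars:
  assumes act: "scalar_action h A V \<rho>" and closed: "algebra_closed A"
  shows "representation (extend_scalars h A) V (quotient_action (tensor_action \<rho>))"
    and "a \<in> carrier A \<Longrightarrow> v \<in> V \<Longrightarrow>
      quotient_action (tensor_action \<rho>) (pure_tensor h A c a) v = vscale c (\<rho> a v)"
proof -
  note hyps = scalar_action_tensor[OF act] formal_tensors_closed[OF closed]
  have sub: "tensor_subgroup h A \<subseteq> carrier (formal_tensors A)"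
    using tensor_subgroup_kills(1)[OF act closed] by blast
  have ne: "tensor_subgroup h A \<noteq> {}"
    unfolding tensor_subgroup_def using generate.one by (metis empty_iff)
  note hyps = hyps sub ne tensor_subgroup_kills(2)[OF act closed]
  show "representation (extend_scalars h A) V (quotient_action (tensor_action \<rho>))"
    unfolding representation_iff extend_scalars_def
    by (rule scalar_action_quotient[OF hyps])
  show "quotient_action (tensor_action \<rho>) (pure_tensor h A c a) v = vscale c (\<rho> a v)"
    if "a \<in> carrier A" "v \<in> V"
    unfolding pure_tensor_def using that
    by (subst quotient_action_coset[OF hyps]) (auto simp: formal_tensors_simps)
qed

lemma pure_tensor_mem: "a \<in> carrier A \<Longrightarrow> pure_tensor h A c a \<in> carrier (extend_scalars h A)"
proof -
  assume "a \<in> carrier A"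
  then have "frag_of (c, a) \<in> carrier (formal_tensors A)"
    by (simp add: formal_tensors_simps)
  then show ?thesis
    unfolding pure_tensor_def extend_scalars_def quotient_algebra_simps(1) by blast
qed

section \<open>Standard tableaux\<close>

text \<open>The componentwise order inside one diagram. It also compares nodes that share neither a
  row nor a column, which \<open>standard_tableaux\<close> does not mention.\<close>

definition node_less :: "'m dm_node \<Rightarrow> 'm dm_node \<Rightarrow> bool" where
  "node_less s t \<longleftrightarrow> snd s = snd t \<and> fst (fst s) \<le> fst (fst t) \<and> snd (fst s) \<le> snd (fst t) \<and> s \<noteq> t"

definition node_covers :: "'m dm_node \<Rightarrow> 'm dm_node \<Rightarrow> bool" where
  "node_covers s t \<longleftrightarrow> snd s = snd t \<and>
    (fst t = (fst (fst s) + 1, snd (fst s)) \<or> fst t = (fst (fst s), snd (fst s) + 1))"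

definition node_diag :: "'m dm_node \<Rightarrow> int" where
  "node_diag s = int (snd (fst s)) - int (fst (fst s))"

abbreviation swap_entries :: "'m dm_tableau \<Rightarrow> nat \<Rightarrow> 'm dm_tableau" where
  "swap_entries T i \<equiv> tableau_perm T (transpose i (i + 1))"

lemma tableau_perm_transpose: "tableau_perm T (transpose a b) = T \<circ> transpose a b"
  by (simp add: tableau_perm_def)

lemma tableau_perm_transpose_apply: "tableau_perm T (transpose a b) j = T (transpose a b j)"
  by (simp add: tableau_perm_transpose)

lemma tableau_perm_transpose_twice [simp]:
  "tableau_perm (tableau_perm T (transpose a b)) (transpose a b) = T"
  by (auto simp: tableau_perm_transpose_apply)

section \<open>Diagrams of multipartitions and their nodes\<close>

lemma multipartition_partition:
  "\<Lambda> \<in> multipartitions d n \<Longrightarrow> k \<in> {1..d} \<Longrightarrow> is_partition (\<Lambda> k l)"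
  by (auto simp: multipartitions_def PiE_iff)

lemma young_diagram_downward:
  assumes "is_partition xs" "(x', y') \<in> young_diagram xs" "1 \<le> x" "x \<le> x'" "1 \<le> y" "y \<le> y'"
  shows "(x, y) \<in> young_diagram xs"
proof -
  have "xs ! (x' - 1) \<le> xs ! (x - 1)"
  proof (cases "x = x'")
    case False
    then have "x - 1 < x' - 1" "x' - 1 < length xs"
      using assms by (auto simp: young_diagram_def)
    then show ?thesis
      using assms(1) unfolding is_partition_def sorted_wrt_iff_nth_less by simp
  qed simp
  then show ?thesis
    using assms by (auto simp: young_diagram_def)
qed

lemma dm_nodes_downward:
  assumes "\<Lambda> \<in> multipartitions d n" "t \<in> dm_nodes d \<Lambda>" "snd s = snd t"
    "1 \<le> fst (fst s)" "fst (fst s) \<le> fst (fst t)" "1 \<le> snd (fst s)" "snd (fst s) \<le> snd (fst t)"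
  shows "s \<in> dm_nodes d \<Lambda>"
proof -
  obtain x y x' y' k l where s: "s = ((x, y), k, l)" and t: "t = ((x', y'), k, l)"
    using assms(3) by (metis surj_pair snd_conv)
  show ?thesis
    using assms(2,4-) multipartition_partition[OF assms(1)] unfolding s t
    by (auto simp: dm_nodes_def intro: young_diagram_downward)
qed

lemma dm_nodes_pos: "t \<in> dm_nodes d \<Lambda> \<Longrightarrow> 1 \<le> fst (fst t) \<and> 1 \<le> snd (fst t) \<and> fst (snd t) \<in> {1..d}"
  by (auto simp: dm_nodes_def young_diagram_def)

text \<open>No part is zero, so every row meets the first column and the diagram determines the
  number of parts.\<close>

lemma is_partition_row: "is_partition xs \<Longrightarrow> 1 \<le> x \<Longrightarrow> (x, 1) \<in> young_diagram xs \<longleftrightarrow> x \<le> length xs"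
  by (cases x) (auto simp: young_diagram_def is_partition_def Suc_le_eq intro!: gr0I dest: nth_mem)

lemma young_diagram_inj:
  assumes "is_partition xs" "is_partition ys" "young_diagram xs = young_diagram ys"
  shows "xs = ys"
proof (rule nth_equalityI)
  have "x \<le> length xs \<longleftrightarrow> x \<le> length ys" if "1 \<le> x" for x
    using is_partition_row[OF assms(1) that] is_partition_row[OF assms(2) that] assms(3) by simp
  from this[of "length xs"] this[of "length ys"] show len: "length xs = length ys"
    by (cases "length xs"; cases "length ys") auto
  fix i assume i: "i < length xs"
  have row: "{y. (i + 1, y) \<in> young_diagram zs} = {1..zs ! i}" if "i < length zs" for zs
    using that by (auto simp: young_diagram_def)
  show "xs ! i = ys ! i"
    using arg_cong[OF row[of xs], of card] arg_cong[OF row[of ys], of card] i len assms(3) by simp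
qed

lemma dm_nodes_inj:
  assumes \<Lambda>: "\<Lambda> \<in> multipartitions d n" and \<Lambda>': "\<Lambda>' \<in> multipartitions d n'"
    and eq: "dm_nodes d \<Lambda> = dm_nodes d \<Lambda>'"
  shows "\<Lambda> = \<Lambda>'"
proof (rule PiE_ext)
  show "\<Lambda> \<in> {1..d} \<rightarrow>\<^sub>E UNIV" "\<Lambda>' \<in> {1..d} \<rightarrow>\<^sub>E UNIV"
    using \<Lambda> \<Lambda>' by (auto simp: multipartitions_def PiE_iff)
  fix k assume k: "k \<in> {1..d}"
  have "\<theta> \<in> young_diagram (\<Lambda> k l) \<longleftrightarrow> \<theta> \<in> young_diagram (\<Lambda>' k l)" for \<theta> l
  proof -
    have "(\<theta>, k, l) \<in> dm_nodes d \<Lambda> \<longleftrightarrow> (\<theta>, k, l) \<in> dm_nodes d \<Lambda>'"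
      by (simp add: eq)
    then show ?thesis
      using k by (simp add: dm_nodes_def)
  qed
  then show "\<Lambda> k = \<Lambda>' k"
    by (intro ext young_diagram_inj multipartition_partition[OF \<Lambda> k] multipartition_partition[OF \<Lambda>' k])
      blast
qed

lemma young_diagram_Sigma: "young_diagram xs = Sigma {1..length xs} (\<lambda>x. {1..xs ! (x - 1)})"
  by (auto simp: young_diagram_def)

lemma finite_young_diagram [simp]: "finite (young_diagram xs)"
  by (simp add: young_diagram_Sigma)

lemma card_young_diagram: "card (young_diagram xs) = sum_list xs"
proof -
  have "card (young_diagram xs) = (\<Sum>x\<in>{1..length xs}. xs ! (x - 1))"
    by (simp add: young_diagram_Sigma)
  also have "\<dots> = (\<Sum>i\<in>{0..<length xs}. xs ! i)"
    by (rule sum.reindex_bij_witness[of _ Suc "\<lambda>x. x - 1"]) auto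
  finally show ?thesis
    by (simp add: sum_list_sum_nth)
qed

lemma dm_nodes_image:
  "dm_nodes d \<Lambda> = (\<lambda>(p, \<theta>). (\<theta>, p)) ` Sigma ({1..d} \<times> UNIV) (\<lambda>p. young_diagram (\<Lambda> (fst p) (snd p)))"
  by (force simp: dm_nodes_def)

lemma card_dm_nodes:
  fixes \<Lambda> :: "nat \<Rightarrow> 'm::finite \<Rightarrow> nat list"
  assumes "\<Lambda> \<in> multipartitions d n"
  shows "finite (dm_nodes d \<Lambda>)" and "card (dm_nodes d \<Lambda>) = n"
proof -
  let ?S = "Sigma ({1..d} \<times> (UNIV :: 'm set)) (\<lambda>p. young_diagram (\<Lambda> (fst p) (snd p)))"
  show "finite (dm_nodes d \<Lambda>)"
    unfolding dm_nodes_image by (intro finite_imageI finite_SigmaI) auto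
  have "card (dm_nodes d \<Lambda>) = card ?S"
    unfolding dm_nodes_image by (rule card_image) (auto simp: inj_on_def)
  also have "\<dots> = (\<Sum>p\<in>{1..d} \<times> UNIV. sum_list (\<Lambda> (fst p) (snd p)))"
    by (subst card_SigmaI) (auto simp: card_young_diagram)
  also have "\<dots> = n"
    using assms by (simp add: multipartitions_def sum.cartesian_product case_prod_unfold)
  finally show "card (dm_nodes d \<Lambda>) = n" .
qed

text \<open>Listing the nodes by increasing \<open>x + y\<close> gives a standard tableau.\<close>

lemma standard_tableau_exists:
  assumes "\<Lambda> \<in> multipartitions d n"
  shows "standard_tableaux d n \<Lambda> \<noteq> {}"
proof -
  define w :: "'a dm_node \<Rightarrow> nat" where "w s = fst (fst s) + snd (fst s)" for s
  obtain xs where xs: "set xs = dm_nodes d \<Lambda>" "distinct xs"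
    using finite_distinct_list[OF card_dm_nodes(1)[OF assms]] by blast
  define ys where "ys = sort_key w xs"
  have ys: "set ys = dm_nodes d \<Lambda>" "distinct ys" "length ys = n" "sorted (map w ys)"
    using xs card_dm_nodes[OF assms] distinct_card[of xs] by (auto simp: ys_def)
  define T where "T = restrict (\<lambda>i. ys ! (i - 1)) {1..n}"
  have mono: "w (T i) \<le> w (T j)" if "i \<in> {1..n}" "j \<in> {1..n}" "i \<le> j" for i j
    using sorted_nth_mono[OF ys(4), of "i - 1" "j - 1"] that ys(3) by (auto simp: T_def)
  have "bij_betw (\<lambda>i. ys ! i) {..<n} (dm_nodes d \<Lambda>)"
    using bij_betw_nth[OF ys(2), of "{..<n}"] ys by (simp add: lessThan_atLeast0)
  moreover have "bij_betw (\<lambda>i. i - 1) {1..n} {..<n}"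
    by (rule bij_betw_byWitness[of _ Suc]) auto
  ultimately have "bij_betw ((\<lambda>i. ys ! i) \<circ> (\<lambda>i. i - 1)) {1..n} (dm_nodes d \<Lambda>)"
    by (rule bij_betw_trans[rotated])
  then have "bij_betw T {1..n} (dm_nodes d \<Lambda>)"
    by (subst bij_betw_cong[of _ _ "(\<lambda>i. ys ! i) \<circ> (\<lambda>i. i - 1)"]) (auto simp: T_def)
  moreover have "T \<in> extensional {1..n}"
    by (simp add: T_def)
  moreover have "i < j" if "i \<in> {1..n}" "j \<in> {1..n}" "w (T i) < w (T j)" for i j
    using mono[OF that(2,1)] that(3) by linarith
  ultimately have "T \<in> standard_tableaux d n \<Lambda>"
    by (auto simp: standard_tableaux_def dm_tableaux_def w_def)
  then show ?thesis by blast
qed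

section \<open>The order of the entries in a standard tableau\<close>

locale tableau_shape =
  fixes d n :: nat and \<Lambda> :: "nat \<Rightarrow> 'm::finite \<Rightarrow> nat list"
  assumes shape: "\<Lambda> \<in> multipartitions d n"
begin

abbreviation "Std \<equiv> standard_tableaux d n \<Lambda>"

lemma std_node: "T \<in> Std \<Longrightarrow> i \<in> {1..n} \<Longrightarrow> T i \<in> dm_nodes d \<Lambda>"
  by (auto simp: standard_tableaux_def dm_tableaux_def dest: bij_betwE)

lemma std_inj: "T \<in> Std \<Longrightarrow> inj_on T {1..n}"
  by (auto simp: standard_tableaux_def dm_tableaux_def bij_betw_def)

lemma std_image: "T \<in> Std \<Longrightarrow> T ` {1..n} = dm_nodes d \<Lambda>"
  by (auto simp: standard_tableaux_def dm_tableaux_def bij_betw_def)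

lemma std_ext: "T \<in> Std \<Longrightarrow> T \<in> extensional {1..n}"
  by (auto simp: standard_tableaux_def dm_tableaux_def)

text \<open>For nodes in different rows and columns, both are compared with the corner in the row of
  the first and the column of the second; it belongs to the diagram by downward closure.\<close>

lemma std_less:
  assumes T: "T \<in> Std" and ij: "i \<in> {1..n}" "j \<in> {1..n}" and less: "node_less (T i) (T j)"
  shows "i < j"
proof -
  obtain x y x' y' k l where i: "T i = ((x, y), k, l)" and j: "T j = ((x', y'), k, l)"
    using less unfolding node_less_def by (metis surj_pair snd_conv)
  have le: "x \<le> x'" "y \<le> y'" "(x, y) \<noteq> (x', y')"
    using less by (auto simp: node_less_def i j)
  have std: "a < b" if "a \<in> {1..n}" "b \<in> {1..n}" "T a = ((u, v), k, l)" "T b = ((u', v'), k, l)"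
    "u = u' \<and> v < v' \<or> v = v' \<and> u < u'" for a b u v u' v'
    using T that unfolding standard_tableaux_def by blast
  show ?thesis
  proof (cases "x = x' \<or> y = y'")
    case True
    then show ?thesis
      using std[OF ij i j] le by auto
  next
    case False
    have "((x, y'), k, l) \<in> dm_nodes d \<Lambda>"
      using dm_nodes_downward[OF shape std_node[OF T ij(2)], of "((x, y'), k, l)"] le
        dm_nodes_pos[OF std_node[OF T ij(1)]] dm_nodes_pos[OF std_node[OF T ij(2)]] by (simp add: i j)
    then obtain m where m: "m \<in> {1..n}" "T m = ((x, y'), k, l)"
      using std_image[OF T] by force
    show ?thesis
      using std[OF ij(1) m(1) i m(2)] std[OF m(1) ij(2) m(2) j] False le by auto
  qed
qed

lemma std_between:
  assumes T: "T \<in> Std" and ij: "i \<in> {1..n}" "j \<in> {1..n}"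
    and "node_less (T i) s" "node_less s (T j)"
  obtains m where "i < m" "m < j" "T m = s"
proof -
  have "s \<in> dm_nodes d \<Lambda>"
    using dm_nodes_downward[OF shape std_node[OF T ij(2)], of s] assms(4,5)
      dm_nodes_pos[OF std_node[OF T ij(1)]] by (auto simp: node_less_def)
  then obtain m where m: "m \<in> {1..n}" "T m = s"
    using std_image[OF T] by force
  then show ?thesis
    using std_less[OF T ij(1) m(1)] std_less[OF T m(1) ij(2)] assms(4,5) that by simp
qed

text \<open>A node strictly between the two would contain an entry strictly between \<open>i\<close>
  and \<open>i + 1\<close>.\<close>

lemma consecutive_covers:
  assumes T: "T \<in> Std" and i: "1 \<le> i" "i < n" and less: "node_less (T i) (T (i + 1))"
  shows "node_covers (T i) (T (i + 1))"
proof (rule ccontr)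
  assume not: "\<not> ?thesis"
  obtain x y x' y' k l where t: "T i = ((x, y), k, l)" "T (i + 1) = ((x', y'), k, l)"
    using less unfolding node_less_def by (metis surj_pair snd_conv)
  \<comment> \<open>One step from \<open>T i\<close> towards \<open>T (i + 1)\<close>: down if the
    target lies in a lower row, otherwise to the right.\<close>
  define s where "s = (if x < x' then ((x + 1, y), k, l) else ((x, y + 1), k, l))"
  have "node_less (T i) s" "node_less s (T (i + 1))"
    using less not by (auto simp: node_less_def node_covers_def s_def t t(2)[simplified])
  then show False
    using std_between[OF T, of i "i + 1" s] i by (metis Suc_eq_plus1 atLeastAtMost_iff
        le_SucI less_Suc_eq_le less_eq_Suc_le not_less)
qed

text \<open>The lower and the right neighbour of the upper node both lie strictly between the two
  nodes, so at least two entries separate \<open>i\<close> from \<open>j\<close>. The resulting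
  bound 3 is what the braid relation, which involves three consecutive entries, requires.\<close>

lemma same_diag_far_aux:
  assumes T: "T \<in> Std" and ij: "i \<in> {1..n}" "j \<in> {1..n}"
    and "snd (T i) = snd (T j)" "node_diag (T i) = node_diag (T j)" "fst (fst (T i)) < fst (fst (T j))"
  shows "i + 3 \<le> j"
proof -
  obtain x y x' y' k l where t: "T i = ((x, y), k, l)" "T j = ((x', y'), k, l)"
    using assms(4) by (metis surj_pair snd_conv)
  have xy: "x < x'" "y < y'"
    using assms(5,6) by (auto simp: t node_diag_def)
  obtain a where a: "i < a" "a < j" "T a = ((x + 1, y), k, l)"
    by (rule std_between[OF T ij, of "((x + 1, y), k, l)"]) (use xy in \<open>auto simp: node_less_def t\<close>)
  obtain b where b: "i < b" "b < j" "T b = ((x, y + 1), k, l)"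
    by (rule std_between[OF T ij, of "((x, y + 1), k, l)"]) (use xy in \<open>auto simp: node_less_def t\<close>)
  have "a \<noteq> b"
    using a b by auto
  then show ?thesis
    using a b by linarith
qed

lemma same_diag_far:
  assumes "T \<in> Std" "i \<in> {1..n}" "j \<in> {1..n}" "i < j" "j < i + 3"
    and "snd (T i) = snd (T j)"
  shows "node_diag (T i) \<noteq> node_diag (T j)"
proof
  assume d: "node_diag (T i) = node_diag (T j)"
  then have "fst (fst (T i)) = fst (fst (T j))"
    using same_diag_far_aux[of T i j] same_diag_far_aux[of T j i] assms by (metis leD linorder_neqE_nat
        add_lessD1 less_le_trans not_less_iff_gr_or_eq)
  then have "T i = T j"
    using d assms(6) by (auto simp: node_diag_def prod_eq_iff)
  then show False
    using std_inj[OF assms(1)] assms(2-4) by (auto dest: inj_onD)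
qed

text \<open>Incomparable nodes of one diagram lie on diagonals at distance at least 2. So nodes on
  neighbouring diagonals are comparable, and standardness fixes the direction. This rules out zeros
  of the numerator of \<open>coeff_swap\<close> at admissible exchanges.\<close>

lemma adjacent_diag_covers:
  assumes T: "T \<in> Std" and i: "1 \<le> i" "i < n" and snd: "snd (T i) = snd (T (i + 1))"
    and diag: "\<bar>node_diag (T i) - node_diag (T (i + 1))\<bar> = 1"
  shows "node_covers (T i) (T (i + 1))"
proof -
  obtain x y x' y' k l where t: "T i = ((x, y), k, l)" "T (i + 1) = ((x', y'), k, l)"
    using snd by (metis surj_pair snd_conv)
  have "node_less (T i) (T (i + 1)) \<or> node_less (T (i + 1)) (T i)"
  proof -
    have "(int y - int x) - (int y' - int x') = 1 \<or> (int y' - int x') - (int y - int x) = 1"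
      using diag unfolding t node_diag_def by (simp add: abs_if split: if_splits)
    then have "x \<le> x' \<and> y \<le> y' \<and> (x, y) \<noteq> (x', y') \<or> x' \<le> x \<and> y' \<le> y \<and> (x, y) \<noteq> (x', y')"
      unfolding prod.inject by linarith
    then show ?thesis
      unfolding t node_less_def by auto
  qed
  moreover have "\<not> node_less (T (i + 1)) (T i)"
    using std_less[OF T, of "i + 1" i] i by auto
  ultimately show ?thesis
    using consecutive_covers[OF T i] by blast
qed

lemma node_covers_less: "node_covers s t \<Longrightarrow> node_less s t"
  by (cases s; cases t) (auto simp: node_covers_def node_less_def)

lemma not_covers_reverse:
  assumes "T \<in> Std" "1 \<le> i" "i < n"
  shows "\<not> node_covers (T (i + 1)) (T i)"
  using std_less[OF assms(1), of "i + 1" i] node_covers_less assms by fastforce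

section \<open>Exchanging consecutive entries\<close>

lemma swap_tableau:
  assumes "T \<in> Std" "1 \<le> i" "i < n"
  shows "swap_entries T i \<in> dm_tableaux d n \<Lambda>"
proof -
  have tau: "bij_betw (transpose i (i + 1)) {1..n} {1..n}"
    by (rule bij_betw_byWitness[of _ "transpose i (i + 1)"])
      (use assms in \<open>auto simp: transpose_def\<close>)
  have "bij_betw (swap_entries T i) {1..n} (dm_nodes d \<Lambda>)"
    unfolding tableau_perm_transpose using assms(1)
    by (intro bij_betw_trans[OF tau]) (auto simp: standard_tableaux_def dm_tableaux_def)
  moreover have "swap_entries T i \<in> extensional {1..n}"
    using std_ext[OF assms(1)] assms(2,3) by (auto simp: extensional_def tableau_perm_transpose_apply transpose_def)
  ultimately show ?thesis
    by (simp add: dm_tableaux_def)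
qed

text \<open>The exchange alters the relative order of the pair \<open>i\<close>,
  \<open>i + 1\<close> only, so it destroys standardness exactly when their nodes are comparable,
  and comparable nodes of consecutive entries form a covering pair.\<close>

lemma swap_standard_iff:
  assumes T: "T \<in> Std" and i: "1 \<le> i" "i < n"
  shows "swap_entries T i \<in> Std \<longleftrightarrow> \<not> node_covers (T i) (T (i + 1))"
proof
  assume S: "swap_entries T i \<in> Std"
  show "\<not> node_covers (T i) (T (i + 1))"
    using std_less[OF S, of "i + 1" i] i node_covers_less[of "T i" "T (i + 1)"]
    by (auto simp: tableau_perm_transpose_apply)
next
  assume not: "\<not> node_covers (T i) (T (i + 1))"
  show "swap_entries T i \<in> Std"
    unfolding standard_tableaux_def
  proof (intro CollectI conjI swap_tableau[OF assms] ballI allI impI)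
    fix a b x y x' y' k l
    assume ab: "a \<in> {1..n}" "b \<in> {1..n}" and *: "swap_entries T i a = ((x, y), k, l) \<and>
      swap_entries T i b = ((x', y'), k, l) \<and> (x = x' \<and> y < y' \<or> y = y' \<and> x < x')"
    let ?a = "transpose i (i + 1) a" and ?b = "transpose i (i + 1) b"
    have "node_less (T ?a) (T ?b)"
      using * by (auto simp: node_less_def tableau_perm_transpose_apply)
    moreover from this have "?a < ?b"
      by (rule std_less[OF T, rotated 2]) (use ab i in \<open>auto simp: transpose_def\<close>)
    ultimately show "a < b"
      using not consecutive_covers[OF T i] by (auto simp: transpose_def split: if_splits)
  qed
qed

text \<open>\<open>T\<close> is sorted into \<open>S\<close> by exchanging neighbours. If
  \<open>S\<close> places the node of \<open>i + 1\<close> before that of \<open>i\<close>, then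
  \<open>T i\<close> is not below \<open>T (i + 1)\<close> because \<open>S\<close> is standard, so
  the exchange is admissible.\<close>

lemma std_swap_induct [consumes 2, case_names base step]:
  assumes T: "T \<in> Std" and S: "S \<in> Std"
    and base: "P T"
    and step: "\<And>T i. T \<in> Std \<Longrightarrow> 1 \<le> i \<Longrightarrow> i < n \<Longrightarrow> swap_entries T i \<in> Std \<Longrightarrow> P T \<Longrightarrow>
      P (swap_entries T i)"
  shows "P S"
proof -
  define pos where "pos = inv_into {1..n} S"
  have pos: "S (pos s) = s" "pos s \<in> {1..n}" if "s \<in> dm_nodes d \<Lambda>" for s
    using f_inv_into_f[of s S "{1..n}"] inv_into_into[of s S "{1..n}"] that std_image[OF S]
    unfolding pos_def by blast+
  \<comment> \<open>As in the rearrangement inequality, exchanging a descent raises this sum, namely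
    by \<open>pos (T i) - pos (T (i + 1))\<close>; it is bounded by the cube of \<open>n\<close>, so
    the sorting ends.\<close>
  define \<mu> where "\<mu> T = (\<Sum>j\<in>{1..n}. j * pos (T j))" for T
  have bound: "\<mu> T \<le> n * (n * n)" if "T \<in> Std" for T
  proof -
    have "\<mu> T \<le> of_nat (card {1..n}) * (n * n)"
      unfolding \<mu>_def
      by (rule sum_bounded_above) (use pos(2)[OF std_node[OF that]] in \<open>auto intro!: mult_le_mono\<close>)
    then show ?thesis by simp
  qed
  show ?thesis
    using T base
  proof (induction "n * (n * n) - \<mu> T" arbitrary: T rule: less_induct)
    case less
    note T = less.prems(1)
    note node = std_node[OF T]
    show ?case
    proof (cases "\<exists>i. 1 \<le> i \<and> i < n \<and> pos (T (i + 1)) < pos (T i)")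
      case True
      then obtain i where i: "1 \<le> i" "i < n" and gt: "pos (T (i + 1)) < pos (T i)"
        by blast
      have "\<not> node_covers (T i) (T (i + 1))"
        using std_less[OF S, of "pos (T i)" "pos (T (i + 1))"] node_covers_less[of "T i" "T (i + 1)"]
          pos node[of i] node[of "i + 1"] i gt by auto
      then have T': "swap_entries T i \<in> Std"
        using swap_standard_iff[OF T i] by simp
      have "\<mu> T < \<mu> (swap_entries T i)"
      proof -
        have split: "(\<Sum>j\<in>{1..n}. f j) = f i + f (i + 1) + (\<Sum>j\<in>{1..n} - {i, i + 1}. f j)" for f :: "nat \<Rightarrow> nat"
          using i sum.subset_diff[of "{i, i + 1}" "{1..n}" f] by simp
        have "(\<Sum>j\<in>{1..n} - {i, i + 1}. j * pos (swap_entries T i j))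
            = (\<Sum>j\<in>{1..n} - {i, i + 1}. j * pos (T j))"
          by (rule sum.cong) (auto simp: tableau_perm_transpose_apply transpose_def)
        moreover have "i * a + (i + 1) * b < i * b + (i + 1) * a" if "b < a" for a b
          using that by simp
        ultimately show ?thesis
          unfolding \<mu>_def split using gt by (simp add: tableau_perm_transpose_apply)
      qed
      then show ?thesis
        using less.hyps[OF _ T' step[OF T i T' less.prems(2)]] bound[OF T'] by linarith
    next
      case False
      have lt: "pos (T i) < pos (T (i + 1))" if i: "1 \<le> i" "i < n" for i
      proof -
        have "T i \<noteq> T (i + 1)"
          using std_inj[OF T] i by (auto dest: inj_onD)
        then have "pos (T i) \<noteq> pos (T (i + 1))"
          using pos(1)[of "T i"] pos(1)[of "T (i + 1)"] node[of i] node[of "i + 1"] i by auto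
        then show ?thesis
          using False i by (meson linorder_neqE_nat)
      qed
      \<comment> \<open>Without descents, \<open>pos (T i)\<close> increases strictly from
        \<open>{1..n}\<close> into itself. Upward induction from 1 and downward induction from
        \<open>n\<close> bound it by \<open>i\<close> from both sides.\<close>
      have ge: "i \<le> n \<longrightarrow> i \<le> pos (T i)" if "1 \<le> i" for i
        using that
      proof (induction i rule: nat_induct_at_least)
        case base
        then show ?case using pos(2)[OF node[of 1]] by auto
      next
        case (Suc i)
        then show ?case using lt[of i] by auto
      qed
      have le: "pos (T i) \<le> i" if "1 \<le> i" "i \<le> n" for i
        using that(2,1)
      proof (induction i rule: inc_induct)
        case base
        then show ?case using pos(2)[OF node[of n]] by auto
      next
        case (step i)
        then show ?case using lt[of i] by auto
      qed
      have "T i = S i" if i: "i \<in> {1..n}" for i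
        using pos(1)[OF node[OF i]] ge[of i] le[of i] i by auto
      then have "T = S"
        using std_ext[OF T] std_ext[OF S] by (intro extensionalityI) auto
      then show ?thesis
        using less.prems(2) by simp
    qed
  qed
qed

end

text \<open>If \<open>T i\<close> were higher on the diagonal than \<open>S i\<close>, it would lie
  in the shape of \<open>S\<close>, which would place it at some \<open>j < i\<close>. There both
  tableaux agree, so \<open>T\<close> would contain the node twice. The assumption
  \<open>before\<close> is the induction hypothesis of the caller.\<close>

lemma tableau_determined_aux:
  assumes "tableau_shape d n \<Lambda>" and "tableau_shape d n \<Lambda>'"
    and T: "T \<in> standard_tableaux d n \<Lambda>" and S: "S \<in> standard_tableaux d n \<Lambda>'"
    and i: "i \<in> {1..n}" and eq: "snd (T i) = snd (S i)" "node_diag (T i) = node_diag (S i)"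
    and before: "\<And>j. j \<in> {1..n} \<Longrightarrow> j < i \<Longrightarrow> T j = S j"
  shows "\<not> fst (fst (T i)) < fst (fst (S i))"
proof
  interpret T: tableau_shape d n \<Lambda> by fact
  interpret S: tableau_shape d n \<Lambda>' by fact
  assume less: "fst (fst (T i)) < fst (fst (S i))"
  have nl: "node_less (T i) (S i)"
    using less eq by (auto simp: node_less_def node_diag_def)
  have "T i \<in> dm_nodes d \<Lambda>'"
    using dm_nodes_downward[OF S.shape S.std_node[OF S i], of "T i"] nl
      dm_nodes_pos[OF T.std_node[OF T i]] by (auto simp: node_less_def)
  then obtain j where j: "j \<in> {1..n}" "S j = T i"
    using S.std_image[OF S] by force
  then have "j < i"
    using S.std_less[OF S j(1) i] nl by simp
  then have "T j = T i"
    using before[OF j(1)] j(2) by simp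
  then show False
    using T.std_inj[OF T] i j(1) \<open>j < i\<close> by (auto dest: inj_onD)
qed

text \<open>Along each diagonal of a diagram the nodes are filled in order, so the diagonals of
  the successive entries determine the tableau, and with it its shape.\<close>

lemma tableau_determined:
  fixes \<Lambda> \<Lambda>' :: "nat \<Rightarrow> 'm::finite \<Rightarrow> nat list"
  assumes shapes: "\<Lambda> \<in> multipartitions d n" "\<Lambda>' \<in> multipartitions d n"
    and T: "T \<in> standard_tableaux d n \<Lambda>" and S: "S \<in> standard_tableaux d n \<Lambda>'"
    and eq: "\<And>i. i \<in> {1..n} \<Longrightarrow> snd (T i) = snd (S i) \<and> node_diag (T i) = node_diag (S i)"
  shows "T = S" and "\<Lambda> = \<Lambda>'"
proof -
  interpret T: tableau_shape d n \<Lambda> by standard (rule shapes)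
  interpret S: tableau_shape d n \<Lambda>' by standard (rule shapes)
  have "i \<in> {1..n} \<Longrightarrow> T i = S i" for i
  proof (induction i rule: less_induct)
    case (less i)
    have "fst (fst (T i)) = fst (fst (S i))"
      using tableau_determined_aux[OF T.tableau_shape_axioms S.tableau_shape_axioms T S less.prems]
        tableau_determined_aux[OF S.tableau_shape_axioms T.tableau_shape_axioms S T less.prems]
        less.IH eq[OF less.prems] by (metis linorder_neqE_nat)
    then show ?case
      using eq[OF less.prems] by (auto simp: node_diag_def prod_eq_iff)
  qed
  then show TS: "T = S"
    using T.std_ext[OF T] S.std_ext[OF S] by (intro extensionalityI) auto
  show "\<Lambda> = \<Lambda>'"
    using dm_nodes_inj[OF shapes] T.std_image[OF T] S.std_image[OF S] TS by simp
qed

section \<open>Contents\<close>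

abbreviation (input) frac_q :: "'m::{finite,linorder} ratfun" where
  "frac_q \<equiv> to_fract (laurent_q 1)"

lemma laurent_q_add: "laurent_q j * laurent_q k = laurent_q (j + k)"
  by (simp add: laurent_q_def mult_single single_add)

lemma laurent_q_0: "laurent_q 0 = 1"
  by (simp add: laurent_q_def)

lemma single_eq_0_iff: "Poly_Mapping.single x c = 0 \<longleftrightarrow> c = 0"
  by (metis lookup_single_eq lookup_zero single_zero)

lemma frac_q_nonzero: "frac_q \<noteq> 0"
  by (simp add: laurent_q_def single_eq_0_iff)

lemma laurent_q_inverse: "to_fract (laurent_q (- k)) = inverse (to_fract (laurent_q k))"
proof -
  have "to_fract (laurent_q (- k)) * to_fract (laurent_q k) = 1"
    by (simp only: to_fract_mult[symmetric] laurent_q_add) (simp add: laurent_q_0)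
  then show ?thesis
    by (metis inverse_unique mult.commute)
qed

lemma frac_q_power_int: "frac_q powi k = to_fract (laurent_q k)"
proof -
  have nat: "frac_q ^ j = to_fract (laurent_q (int j))" for j
    by (induction j) (simp_all add: laurent_q_0 laurent_q_add to_fract_mult[symmetric] del: to_fract_mult)
  show ?thesis
  proof (cases "k \<ge> 0")
    case True
    then show ?thesis
      by (simp add: power_int_def nat)
  next
    case False
    then show ?thesis
      using laurent_q_inverse[of "- k", where 'a = 'a] by (simp add: power_int_def nat power_inverse)
  qed
qed

lemma node_content_eq:
  "node_content s = to_fract (laurent_v (snd (snd s)) * laurent_q (2 * node_diag s))"
  by (cases s rule: node_content.cases) (simp add: node_diag_def frac_q_power_int)

lemma node_pos_eq: "node_pos s = fst (snd s)"
  by (cases s rule: node_pos.cases) simp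

text \<open>Both sides are single monomials, so only exponents are compared. The shifts 0, 0 compare
  contents, 0, 2 describe neighbouring nodes, and 1, -1 locate the zeros of the numerator of
  \<open>coeff_swap\<close>.\<close>

lemma shifted_content_eq_iff:
  "to_fract (laurent_q j) * node_content s = to_fract (laurent_q k) * node_content t \<longleftrightarrow>
    snd (snd s) = snd (snd t) \<and> j + 2 * node_diag s = k + 2 * node_diag t"
proof -
  define e where "e l a = Poly_Mapping.single (Some l) 1 + Poly_Mapping.single None a" for l :: 'a and a :: int
  have 1: "laurent_q j * (laurent_v l * laurent_q a) = Poly_Mapping.single (e l (j + a)) 1" for l :: 'a and j a
    by (simp add: laurent_q_def laurent_v_def mult_single e_def single_add ac_simps)
  have 2: "Poly_Mapping.single x (1::complex) = Poly_Mapping.single y 1 \<longleftrightarrow> x = y" for x y :: "'a option \<Rightarrow>\<^sub>0 int"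
    by (metis lookup_single_eq lookup_single_not_eq zero_neq_one)
  have 3: "e l a = e l' b \<longleftrightarrow> l = l' \<and> a = b" for l l' a b
  proof
    assume eq: "e l a = e l' b"
    have "Poly_Mapping.lookup (e l a) None = a" "Poly_Mapping.lookup (e l' b) None = b"
      by (simp_all add: e_def lookup_add lookup_single)
    moreover have "Poly_Mapping.lookup (e l a) (Some l) = 1"
      "Poly_Mapping.lookup (e l' b) (Some l) = (1 when l' = l)"
      by (simp_all add: e_def lookup_add lookup_single when_def)
    ultimately show "l = l' \<and> a = b"
      using eq by (auto simp: when_def split: if_splits)
  qed simp
  show ?thesis
    unfolding node_content_eq to_fract_mult[symmetric] to_fract_eq_iff 1 2 3 by simp
qed

lemma node_content_eq_iff:
  "node_content s = node_content t \<longleftrightarrow> snd (snd s) = snd (snd t) \<and> node_diag s = node_diag t"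
  using shifted_content_eq_iff[of 0 s 0 t] by (simp add: laurent_q_0)

lemma node_content_nonzero: "node_content s \<noteq> 0"
proof -
  have "laurent_v l \<noteq> 0" "laurent_q k \<noteq> 0" for l :: 'a and k
    by (simp_all add: laurent_v_def laurent_q_def single_eq_0_iff)
  then show ?thesis
    by (simp add: node_content_eq)
qed

lemma covers_content:
  assumes "node_covers s t"
  shows "node_content t = frac_q ^ 2 * node_content s \<or> node_content s = frac_q ^ 2 * node_content t"
proof -
  have q2: "frac_q ^ 2 = to_fract (laurent_q 2)"
    using frac_q_power_int[of 2] by simp
  have "snd (snd s) = snd (snd t)" "node_diag t = node_diag s + 1 \<or> node_diag s = node_diag t + 1"
    using assms by (auto simp: node_covers_def node_diag_def)
  then show ?thesis
    using shifted_content_eq_iff[of 0 t 2 s] shifted_content_eq_iff[of 0 s 2 t]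
    by (auto simp: q2 laurent_q_0)
qed


section \<open>The matrix coefficients of the generators\<close>

text \<open>The coefficient with which g_i returns the vector of a tableau having \<open>i\<close>
  in \<open>s\<close> and \<open>i + 1\<close> in \<open>t\<close>.\<close>

definition coeff_diag :: "'m::{finite,linorder} dm_node \<Rightarrow> 'm dm_node \<Rightarrow> 'm ratfun" where
  "coeff_diag s t = (if node_pos s \<noteq> node_pos t then 0
    else node_content t * (frac_q - inverse frac_q) / (node_content t - node_content s))"

text \<open>Where the formula of the paper would produce a nonstandard tableau, \<open>coeff_swap\<close> is set to 0. The
  relations stay true, because they involve \<open>coeff_swap s t\<close> beyond a common factor only through its
  product with \<open>coeff_swap t s\<close>, which vanishes on such pairs anyway.\<close>

definition coeff_swap :: "'m::{finite,linorder} dm_node \<Rightarrow> 'm dm_node \<Rightarrow> 'm ratfun" where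
  "coeff_swap s t = (if node_covers s t \<or> node_covers t s then 0
    else if node_pos s \<noteq> node_pos t then 1
    else (frac_q * node_content t - inverse frac_q * node_content s) /
      (node_content t - node_content s))"

text \<open>This keeps the denominators of \<open>coeff_diag\<close> and \<open>coeff_swap\<close>
  from vanishing; between different components the coefficients have no denominators.\<close>

definition separated :: "'m::{finite,linorder} dm_node \<Rightarrow> 'm dm_node \<Rightarrow> bool" where
  "separated s t \<longleftrightarrow> (node_pos s = node_pos t \<longrightarrow> node_content s \<noteq> node_content t)"

lemma covers_pos: "node_covers s t \<Longrightarrow> node_pos s = node_pos t"
  by (simp add: node_covers_def node_pos_eq)

text \<open>The trace of the 2 by 2 matrix of g_i on a tableau and its exchange. The case
  distinction reflects the factor e_i in the quadratic relation.\<close>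

lemma coeff_diag_add:
  assumes "separated s t"
  shows "coeff_diag s t + coeff_diag t s = (if node_pos s = node_pos t then frac_q - inverse frac_q else 0)"
proof -
  have "y * k / (y - x) + x * k / (x - y) = k" if "x \<noteq> y" for x y k :: "'a ratfun"
  proof -
    have "x * k / (x - y) = - (x * k / (y - x))"
      using minus_divide_right[of "x * k" "y - x"] by simp
    then show ?thesis
      using that by (simp add: diff_divide_distrib[symmetric] left_diff_distrib[symmetric])
  qed
  then show ?thesis
    using assms by (auto simp: coeff_diag_def separated_def)
qed

text \<open>The determinant of that matrix is -1. For a covering pair the left side is zero by
  definition, and the right side vanishes too, since the contents differ by the factor q^2.\<close>

lemma coeff_swap_mult:
  assumes "separated s t"
  shows "coeff_swap s t * coeff_swap t s = 1 + coeff_diag s t * coeff_diag t s"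
proof (cases "node_pos s = node_pos t")
  case False
  then show ?thesis
    using covers_pos[of s t] covers_pos[of t s] by (auto simp: coeff_swap_def coeff_diag_def)
next
  case True
  define q where "q = (frac_q :: 'a ratfun)"
  define x where "x = node_content s"
  define y where "y = node_content t"
  have q: "q \<noteq> 0" and xy: "x \<noteq> y"
    using assms True frac_q_nonzero by (auto simp: separated_def q_def x_def y_def)
  define D where "D = y - x"
  have D: "D \<noteq> 0" "x - y = - D"
    using xy by (auto simp: D_def)
  have rhs: "1 + coeff_diag s t * coeff_diag t s = (D ^ 2 - x * y * (q - inverse q) ^ 2) / D ^ 2"
    using True D by (simp add: coeff_diag_def q_def[symmetric] x_def[symmetric] y_def[symmetric]
        D_def[symmetric] diff_divide_distrib power2_eq_square ac_simps)
  show ?thesis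
  proof (cases "node_covers s t \<or> node_covers t s")
    case c: True
    then have "y = q ^ 2 * x \<or> x = q ^ 2 * y"
      using covers_content[of s t] covers_content[of t s] by (auto simp: q_def x_def y_def)
    moreover have "(q ^ 2 * z - z) ^ 2 = z * (q ^ 2 * z) * (q - inverse q) ^ 2" for z
      using q by (simp add: field_simps power2_eq_square)
    ultimately have "D ^ 2 = x * y * (q - inverse q) ^ 2"
      unfolding D_def by (metis mult.commute power2_commute)
    then show ?thesis
      unfolding rhs using c by (auto simp: coeff_swap_def)
  next
    case False
    then have "coeff_swap s t * coeff_swap t s =
        - ((q * y - inverse q * x) * (q * x - inverse q * y)) / D ^ 2"
      using True D by (simp add: coeff_swap_def q_def[symmetric] x_def[symmetric] y_def[symmetric]
          D_def[symmetric] power2_eq_square)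
    moreover have "- ((q * y - inverse q * x) * (q * x - inverse q * y)) =
        D ^ 2 - x * y * (q - inverse q) ^ 2"
      using q by (simp add: D_def field_simps power2_eq_square)
    ultimately show ?thesis
      unfolding rhs by simp
  qed
qed

text \<open>Both terms have the same symmetric numerator and opposite denominators. This
  cancellation makes g_i X_i g_i diagonal.\<close>

lemma coeff_diag_content:
  assumes "separated s t"
  shows "coeff_diag s t * node_content s + coeff_diag t s * node_content t = 0"
proof (cases "node_pos s = node_pos t")
  case True
  define x where "x = node_content s"
  define y where "y = node_content t"
  have neg: "x * k / (x - y) = - (x * k / (y - x))" for k
    using minus_divide_right[of "x * k" "y - x"] by simp
  show ?thesis
    using True unfolding coeff_diag_def x_def[symmetric] y_def[symmetric] neg
    by (simp add: ac_simps)
qed (simp add: coeff_diag_def)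

text \<open>Comparison of the coefficients at the exchange of the first two of three entries in the
  braid relation, with the factor \<open>coeff_swap x y\<close> removed. Unless all three nodes lie
  in one component, every product vanishes.\<close>

lemma coeff_braid_1:
  assumes "separated x y" "separated x z" "separated y z"
  shows "coeff_diag x y * coeff_diag y z + coeff_diag x z * coeff_diag y x
    = coeff_diag y z * coeff_diag x z"
proof -
  have "b * k / (b - a) * (c * k / (c - b)) + c * k / (c - a) * (a * k / (a - b))
      = c * k / (c - b) * (c * k / (c - a))"
    if "a \<noteq> b" "a \<noteq> c" "b \<noteq> c" for a b c k :: "'a ratfun"
  proof -
    \<comment> \<open>In terms of the differences the denominators are \<open>u\<close>,
      \<open>v\<close> and \<open>u + v\<close>, and the identity becomes polynomial.\<close>
    define u where "u = b - a"
    define v where "v = c - b"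
    have "u \<noteq> 0" "v \<noteq> 0" "u + v \<noteq> 0"
      using that by (auto simp: u_def v_def)
    moreover have "b = a + u" "c = a + u + v"
      by (auto simp: u_def v_def)
    ultimately show ?thesis
      by (simp add: divide_simps) (simp add: algebra_simps)
  qed
  from this[of "node_content x" "node_content y" "node_content z" "frac_q - inverse frac_q"]
  show ?thesis
    using assms by (auto simp: coeff_diag_def separated_def mult.commute[of "_ - _" "_ - _"])
qed

text \<open>The same comparison at the exchange of the last two entries, with
  \<open>coeff_swap y z\<close> removed.\<close>

lemma coeff_braid_2:
  assumes "separated x y" "separated x z" "separated y z"
  shows "coeff_diag x y * coeff_diag x z
    = coeff_diag y z * coeff_diag x y + coeff_diag x z * coeff_diag z y"
proof -
  have "b * k / (b - a) * (c * k / (c - a))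
      = c * k / (c - b) * (b * k / (b - a)) + c * k / (c - a) * (b * k / (b - c))"
    if "a \<noteq> b" "a \<noteq> c" "b \<noteq> c" for a b c k :: "'a ratfun"
  proof -
    define u where "u = b - a"
    define v where "v = c - b"
    have "u \<noteq> 0" "v \<noteq> 0" "u + v \<noteq> 0"
      using that by (auto simp: u_def v_def)
    moreover have "b = a + u" "c = a + u + v"
      by (auto simp: u_def v_def)
    ultimately show ?thesis
      by (simp add: divide_simps) (simp add: algebra_simps)
  qed
  from this[of "node_content x" "node_content y" "node_content z" "frac_q - inverse frac_q"]
  show ?thesis
    using assms by (auto simp: coeff_diag_def separated_def)
qed

text \<open>The comparison at the tableau itself. Writing a for \<open>coeff_diag\<close> and
  eliminating \<open>coeff_swap\<close> by the determinant identity, both sides become a(x,z) (1 +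
  a(x,y) a(y,z)) by the two previous identities.\<close>

lemma coeff_braid_3:
  assumes "separated x y" "separated x z" "separated y z"
  shows "coeff_diag x y * coeff_diag y z * coeff_diag x y + coeff_swap x y * coeff_diag x z * coeff_swap y x
    = coeff_diag y z * coeff_diag x y * coeff_diag y z + coeff_swap y z * coeff_diag x z * coeff_swap z y"
proof -
  have "coeff_diag x y * (coeff_diag x y * coeff_diag y z + coeff_diag x z * coeff_diag y x)
      = coeff_diag y z * (coeff_diag y z * coeff_diag x y + coeff_diag x z * coeff_diag z y)"
    unfolding coeff_braid_1[OF assms] coeff_braid_2[OF assms, symmetric] by (simp add: ac_simps)
  moreover have "coeff_swap x y * coeff_diag x z * coeff_swap y x
      = (1 + coeff_diag x y * coeff_diag y x) * coeff_diag x z"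
    "coeff_swap y z * coeff_diag x z * coeff_swap z y
      = (1 + coeff_diag y z * coeff_diag z y) * coeff_diag x z"
    by (simp_all add: coeff_swap_mult[OF assms(1), symmetric] coeff_swap_mult[OF assms(3), symmetric] ac_simps)
  ultimately show ?thesis
    by (simp add: algebra_simps)
qed

text \<open>Within one component the numerator vanishes only if the content of \<open>s\<close> is
  q^2 times that of \<open>t\<close>, which forces the same diagram and neighbouring
  diagonals.\<close>

lemma coeff_swap_nonzero:
  assumes "separated s t" and "\<not> node_covers s t" "\<not> node_covers t s"
    and "snd s = snd t \<Longrightarrow> \<bar>node_diag s - node_diag t\<bar> \<noteq> 1"
  shows "coeff_swap s t \<noteq> 0"
proof (cases "node_pos s = node_pos t")
  case True
  have "frac_q * node_content t \<noteq> inverse frac_q * node_content s"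
    using assms(4) shifted_content_eq_iff[of 1 t "-1" s] laurent_q_inverse[of 1, where 'a = 'a] True
    by (auto simp: node_pos_eq prod_eq_iff)
  then show ?thesis
    using assms True by (simp add: coeff_swap_def separated_def)
qed (use assms in \<open>simp add: coeff_swap_def\<close>)

section \<open>The operators of the generators\<close>

definition diag_op :: "('b \<Rightarrow> 'k::field) \<Rightarrow> ('b \<Rightarrow>\<^sub>0 'k) \<Rightarrow> ('b \<Rightarrow>\<^sub>0 'k)" where
  "diag_op f = lin_ext (\<lambda>c. c) (\<lambda>T. Poly_Mapping.single T (f T))"

definition op_g :: "nat \<Rightarrow> ('m dm_tableau \<Rightarrow>\<^sub>0 'm::{finite,linorder} ratfun) \<Rightarrow> ('m dm_tableau \<Rightarrow>\<^sub>0 'm ratfun)" where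
  "op_g i = lin_ext (\<lambda>c. c) (\<lambda>T. Poly_Mapping.single T (coeff_diag (T i) (T (i + 1))) +
    Poly_Mapping.single (swap_entries T i) (coeff_swap (T i) (T (i + 1))))"

definition root_value :: "(nat \<Rightarrow> complex) \<Rightarrow> 'm::{finite,linorder} dm_node \<Rightarrow> 'm ratfun" where
  "root_value \<xi> s = to_fract (laurent_const (\<xi> (node_pos s)))"

text \<open>Evaluation assigns an operator to every letter, including those with an index out of
  range, and each must preserve the span of the standard tableaux; out of range, g_i is therefore
  sent to zero.\<close>

fun yh_op :: "nat \<Rightarrow> (nat \<Rightarrow> complex) \<Rightarrow> yh_gen \<Rightarrow>
    ('m dm_tableau \<Rightarrow>\<^sub>0 'm::{finite,linorder} ratfun) \<Rightarrow> ('m dm_tableau \<Rightarrow>\<^sub>0 'm ratfun)" where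
  "yh_op n \<xi> (Gen_t j) = diag_op (\<lambda>T. root_value \<xi> (T j))"
| "yh_op n \<xi> (Gen_g i) = (if 1 \<le> i \<and> i < n then op_g i else (\<lambda>v. 0))"
| "yh_op n \<xi> Gen_X = diag_op (\<lambda>T. node_content (T 1))"
| "yh_op n \<xi> Gen_Xinv = diag_op (\<lambda>T. inverse (node_content (T 1)))"

lemma diag_op_single [simp]: "diag_op f (Poly_Mapping.single T c) = Poly_Mapping.single T (c * f T)"
  by (simp add: diag_op_def lin_ext_single)

lemma op_g_single:
  "op_g i (Poly_Mapping.single T c) = Poly_Mapping.single T (c * coeff_diag (T i) (T (i + 1))) +
    Poly_Mapping.single (swap_entries T i) (c * coeff_swap (T i) (T (i + 1)))"
  by (simp add: op_g_def lin_ext_single vs.scale_right_distrib)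

lemma linear_diag_op: "linear_on UNIV UNIV (diag_op f)"
  unfolding diag_op_def by (rule linear_on_lin_ext)

lemma linear_op_g: "linear_on UNIV UNIV (op_g i)"
  unfolding op_g_def by (rule linear_on_lin_ext)

lemma linear_yh_op: "linear_on UNIV UNIV (yh_op n \<xi> x)"
  by (cases x) (simp_all add: linear_diag_op linear_op_g, simp add: linear_on_def)

lemmas diag_op_add = linear_on_add[OF linear_diag_op UNIV_I UNIV_I]
  and op_g_add = linear_on_add[OF linear_op_g UNIV_I UNIV_I]

lemma lookup_diag_op [simp]: "Poly_Mapping.lookup (diag_op f v) T = f T * Poly_Mapping.lookup v T"
  by (induction v rule: poly_mapping_single_add_induct)
    (auto simp: linear_on_0[OF linear_diag_op] diag_op_add lookup_add lookup_single when_def algebra_simps)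

lemma diag_op_power: "(diag_op f ^^ k) (Poly_Mapping.single T c) = Poly_Mapping.single T (c * f T ^ k)"
  by (induction k) (simp_all add: ac_simps)

section \<open>Constants and roots of unity\<close>

lemma laurent_const_hom:
  "laurent_const a * laurent_const b = laurent_const (a * b)"
  "laurent_const a + laurent_const b = laurent_const (a + b)"
  "laurent_const 1 = 1" "laurent_const 0 = 0"
  by (simp_all add: laurent_const_def mult_single single_add)

lemma laurent_const_inj: "laurent_const a = laurent_const b \<longleftrightarrow> a = b"
  by (metis laurent_const_def lookup_single_eq)

lemma laurent_const_power: "laurent_const a ^ k = laurent_const (a ^ k)"
  by (induction k) (simp_all add: laurent_const_hom)

lemma laurent_const_sum: "(\<Sum>i\<in>A. laurent_const (f i)) = laurent_const (sum f A)"
  by (induction A rule: infinite_finite_induct) (simp_all add: laurent_const_hom)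

lemma to_fract_power: "to_fract (a ^ k) = to_fract a ^ k"
  by (induction k) simp_all

lemma to_fract_sum: "to_fract (sum f A) = (\<Sum>i\<in>A. to_fract (f i))"
  by (induction A rule: infinite_finite_induct) simp_all

lemma single_sum: "(\<Sum>i\<in>A. Poly_Mapping.single x (f i)) = Poly_Mapping.single x (sum f A)"
  by (induction A rule: infinite_finite_induct) (simp_all add: single_add)

text \<open>For distinct roots this is the factorization of x^d - y^d = 0 by x - y. The exponent
  \<open>d - s\<close> in place of \<open>d - Suc s\<close> contributes the extra factor
  \<open>y\<close>.\<close>

lemma roots_of_unity_sum:
  fixes x y :: complex
  assumes "x ^ d = 1" "y ^ d = 1"
  shows "(\<Sum>s<d. y ^ (d - s) * x ^ s) = (if x = y then of_nat d else 0)"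
proof -
  have "(\<Sum>s<d. y ^ (d - s) * x ^ s) = (\<Sum>s<d. y * (y ^ (d - Suc s) * x ^ s))"
    by (rule sum.cong) (auto simp: Suc_diff_Suc power_Suc[symmetric] simp del: power_Suc simp flip: mult.assoc)
  also have "\<dots> = y * (\<Sum>s<d. y ^ (d - Suc s) * x ^ s)"
    by (simp add: sum_distrib_left)
  finally have sum: "(\<Sum>s<d. y ^ (d - s) * x ^ s) = y * (\<Sum>s<d. y ^ (d - Suc s) * x ^ s)" .
  show ?thesis
  proof (cases "x = y")
    case True
    have "(\<Sum>s<d. y ^ (d - s) * x ^ s) = (\<Sum>s<d. 1)"
      by (rule sum.cong) (use assms True in \<open>auto simp flip: power_add\<close>)
    then show ?thesis
      using True by simp
  next
    case False
    have "(x - y) * (\<Sum>s<d. y ^ (d - Suc s) * x ^ s) = 0"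
      using power_diff_sumr2[of x d y] assms by simp
    then show ?thesis
      using False sum by simp
  qed
qed

section \<open>The operators on the span of the standard tableaux\<close>

locale yh_module = tableau_shape d n \<Lambda>
  for d n and \<Lambda> :: "nat \<Rightarrow> 'm::{finite,linorder} \<Rightarrow> nat list" +
  fixes \<xi> :: "nat \<Rightarrow> complex"
  assumes d_pos: "d > 0" and n_pos: "n > 0" and roots: "bij_betw \<xi> {1..d} {z. z ^ d = 1}"
begin

abbreviation "V \<equiv> V_space d n \<Lambda>"

sublocale free_evaluation "to_fract :: 'm laurent \<Rightarrow> 'm ratfun" "yh_op n \<xi>"
  by (intro free_evaluation.intro to_fract_0 to_fract_1 to_fract_add to_fract_mult linear_yh_op)

lemma subspace_V: "vs.subspace V"
proof (rule vs.subspaceI)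
  show "x + y \<in> V" if "x \<in> V" "y \<in> V" for x y
    using that Poly_Mapping.keys_add[of x y] unfolding V_space_def by blast
  show "vscale c x \<in> V" if "x \<in> V" for c x
    using that keys_vscale_subset[of c x] unfolding V_space_def by blast
qed (simp add: V_space_def)

lemma single_mem_V: "T \<in> Std \<Longrightarrow> Poly_Mapping.single T c \<in> V"
  by (auto simp: V_space_def)

lemma linear_on_expand:
  assumes lin: "linear_on V W f" and v: "v \<in> V"
  shows "f v = (\<Sum>T\<in>Poly_Mapping.keys v. vscale (Poly_Mapping.lookup v T) (f (Poly_Mapping.single T 1)))"
proof -
  have keys: "Poly_Mapping.keys v \<subseteq> Std"
    using v by (simp add: V_space_def)
  have "f v = f (\<Sum>T\<in>Poly_Mapping.keys v. vscale (Poly_Mapping.lookup v T) (Poly_Mapping.single T 1))"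
    by (rule arg_cong[OF basis_expansion[of v]])
  also have "\<dots> = (\<Sum>T\<in>Poly_Mapping.keys v. f (vscale (Poly_Mapping.lookup v T) (Poly_Mapping.single T 1)))"
    by (rule linear_on_sum[OF lin subspace_V]) (use keys in \<open>auto intro: single_mem_V\<close>)
  also have "\<dots> = (\<Sum>T\<in>Poly_Mapping.keys v. vscale (Poly_Mapping.lookup v T) (f (Poly_Mapping.single T 1)))"
    by (rule sum.cong[OF refl], rule linear_on_scale[OF lin]) (use keys in \<open>auto intro: single_mem_V\<close>)
  finally show ?thesis .
qed

lemma linear_eq_on_V:
  assumes "linear_on V U f" "linear_on V U' g" and "v \<in> V"
    and "\<And>T. T \<in> Std \<Longrightarrow> f (Poly_Mapping.single T 1) = g (Poly_Mapping.single T 1)"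
  shows "f v = g v"
  unfolding linear_on_expand[OF assms(1,3)] linear_on_expand[OF assms(2,3)]
  using assms(3,4) by (intro sum.cong refl) (auto simp: V_space_def subset_iff)

lemma linear_on_subset: "linear_on UNIV UNIV f \<Longrightarrow> linear_on V UNIV f"
  by (auto simp: linear_on_def)

lemma V_invariantI:
  assumes "linear_on UNIV UNIV f" and "v \<in> V"
    and "\<And>T. T \<in> Std \<Longrightarrow> f (Poly_Mapping.single T 1) \<in> V"
  shows "f v \<in> V"
  unfolding linear_on_expand[OF linear_on_subset[OF assms(1)] assms(2)]
  using assms(2,3) by (intro vs.subspace_sum vs.subspace_scale subspace_V) (auto simp: V_space_def)

text \<open>This is how the convention of a zero vector for nonstandard tableaux is realized; it
  makes \<open>V\<close> stable and lets the checks below ignore nonstandard exchanges.\<close>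

lemma coeff_swap_nonstandard:
  assumes "T \<in> Std" "1 \<le> i" "i < n" "swap_entries T i \<notin> Std"
  shows "coeff_swap (T i) (T (i + 1)) = 0"
  using assms swap_standard_iff[of T i] by (simp add: coeff_swap_def)

lemma op_g_V:
  assumes "1 \<le> i" "i < n" "v \<in> V"
  shows "op_g i v \<in> V"
proof (rule V_invariantI[OF linear_op_g assms(3)])
  fix T assume T: "T \<in> Std"
  show "op_g i (Poly_Mapping.single T 1) \<in> V"
    unfolding op_g_single
    using coeff_swap_nonstandard[OF T assms(1,2)] single_mem_V[OF T] single_mem_V[of "swap_entries T i"]
    by (cases "swap_entries T i \<in> Std")
      (simp_all add: vs.subspace_add[OF subspace_V] vs.subspace_0[OF subspace_V])
qed

lemma diag_op_V: "v \<in> V \<Longrightarrow> diag_op f v \<in> V"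
  by (rule V_invariantI[OF linear_diag_op]) (auto intro: single_mem_V)

lemma yh_op_V: "v \<in> V \<Longrightarrow> yh_op n \<xi> x v \<in> V"
  by (cases x) (auto simp: diag_op_V op_g_V vs.subspace_0[OF subspace_V])

lemma std_separated:
  assumes "T \<in> Std" "1 \<le> i" "i < j" "j < i + 3" "j \<le> n"
  shows "separated (T i) (T j)"
  using same_diag_far[OF assms(1), of i j] assms
  by (auto simp: separated_def node_content_eq_iff node_pos_eq prod_eq_iff)

lemma std_separated_Suc:
  assumes "T \<in> Std" "1 \<le> i" "i < n"
  shows "separated (T i) (T (Suc i))"
  using std_separated[OF assms(1,2), of "Suc i"] assms by simp

lemma root_power: "T \<in> Std \<Longrightarrow> j \<in> {1..n} \<Longrightarrow> \<xi> (node_pos (T j)) ^ d = 1"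
  using bij_betwE[OF roots] dm_nodes_pos[OF std_node] by (fastforce simp: node_pos_eq)

lemma root_inj:
  assumes "s \<in> dm_nodes d \<Lambda>1" "t \<in> dm_nodes d \<Lambda>2"
  shows "root_value \<xi> s = root_value \<xi> t \<longleftrightarrow> node_pos s = node_pos t"
  using dm_nodes_pos[OF assms(1)] dm_nodes_pos[OF assms(2)] roots
  by (auto simp: root_value_def laurent_const_inj node_pos_eq bij_betw_def dest: inj_onD)

text \<open>By orthogonality of the roots of unity, e_i projects onto the tableaux with
  \<open>i\<close> and \<open>i + 1\<close> in the same component; injectivity of
  \<open>\<xi>\<close> turns equality of roots into equality of components.\<close>

lemma ev_e:
  assumes T: "T \<in> Std" and i: "1 \<le> i" "i < n"
  shows "ev (yh_e d i) (Poly_Mapping.single T c) =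
    Poly_Mapping.single T (if node_pos (T i) = node_pos (T (Suc i)) then c else 0)"
proof -
  let ?x = "\<xi> (node_pos (T i))" and ?y = "\<xi> (node_pos (T (Suc i)))"
  have xy: "?x ^ d = 1" "?y ^ d = 1"
    using root_power[OF T] i by auto
  have eq: "?x = ?y \<longleftrightarrow> node_pos (T i) = node_pos (T (Suc i))"
    using root_inj[OF std_node[OF T, of i] std_node[OF T, of "Suc i"]] i
    by (simp add: root_value_def laurent_const_inj)
  have letter_pow: "(ev (yh_t j) ^^ s) (Poly_Mapping.single T c) =
      Poly_Mapping.single T (c * to_fract (laurent_const (\<xi> (node_pos (T j)) ^ s)))" for j s c
  proof -
    have "ev (yh_t j) = diag_op (\<lambda>T. root_value \<xi> (T j))"
      by (simp add: fun_eq_iff ev_letter)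
    then show ?thesis
      by (simp add: diag_op_power root_value_def to_fract_power laurent_const_power[symmetric])
  qed
  have "ev (yh_e d i) (Poly_Mapping.single T c) = Poly_Mapping.single T
      (to_fract (laurent_const (1 / of_nat d)) *
        (\<Sum>s<d. c * to_fract (laurent_const (?y ^ (d - s))) * to_fract (laurent_const (?x ^ s))))"
    by (simp add: yh_e_def ev_mult ev_scalar ev_sum ev_power letter_pow single_sum)
  also have "(\<Sum>s<d. c * to_fract (laurent_const (?y ^ (d - s))) * to_fract (laurent_const (?x ^ s)))
      = c * to_fract (laurent_const (\<Sum>s<d. ?y ^ (d - s) * ?x ^ s))"
    by (simp add: laurent_const_sum[symmetric] to_fract_sum sum_distrib_left laurent_const_hom(1)[symmetric]
        mult.assoc)
  also have "to_fract (laurent_const (1 / of_nat d)) * (c * to_fract (laurent_const (\<Sum>s<d. ?y ^ (d - s) * ?x ^ s)))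
      = c * to_fract (laurent_const (1 / of_nat d * (\<Sum>s<d. ?y ^ (d - s) * ?x ^ s)))"
    by (simp add: laurent_const_hom(1)[symmetric] del: times_divide_eq_left)
  also have "1 / of_nat d * (\<Sum>s<d. ?y ^ (d - s) * ?x ^ s) = (if ?x = ?y then 1 else 0)"
    unfolding roots_of_unity_sum[OF xy] using d_pos by simp
  finally show ?thesis
    by (simp add: eq laurent_const_hom)
qed

text \<open>The off-diagonal entry is a multiple of the sum in \<open>coeff_diag_content\<close>,
  hence zero; the determinant identity turns the diagonal entry into the content of
  \<open>i + 1\<close> plus another multiple of that sum. This serves both the relation of X_1 with
  g_1 and the Jucys-Murphy recursion.\<close>

lemma op_g_conj_diag:
  assumes T: "T \<in> Std" and i: "1 \<le> i" "i < n"
    and f: "\<And>S. S \<in> Std \<Longrightarrow> f S = node_content (S i)"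
  shows "op_g i (diag_op f (op_g i (Poly_Mapping.single T c)))
    = Poly_Mapping.single T (c * node_content (T (i + 1)))"
proof -
  let ?s = "T i" and ?t = "T (Suc i)"
  let ?a = "coeff_diag ?s ?t" and ?b = "coeff_swap ?s ?t"
    and ?a' = "coeff_diag ?t ?s" and ?b' = "coeff_swap ?t ?s"
  note sep = std_separated_Suc[OF T i]
  let ?S = "tableau_perm T (transpose i (Suc i))"
  \<comment> \<open>If the exchange is nonstandard, the hypothesis on \<open>f\<close> says nothing
    about it, but its coefficient is zero.\<close>
  have f': "?b * f ?S = ?b * node_content ?t"
    using coeff_swap_nonstandard[OF T i] f[of ?S]
    by (cases "?S \<in> Std") (auto simp: tableau_perm_transpose_apply)
  have f'': "c * ?b * f ?S * z = c * ?b * node_content ?t * z" for z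
    using arg_cong[OF f', of "\<lambda>u. c * u * z"] by (simp add: mult.assoc)
  have "op_g i (diag_op f (op_g i (Poly_Mapping.single T c))) =
      Poly_Mapping.single T (c * ?a * node_content ?s * ?a) +
      Poly_Mapping.single ?S (c * ?a * node_content ?s * ?b) +
      (Poly_Mapping.single ?S (c * ?b * node_content ?t * ?a') +
      Poly_Mapping.single T (c * ?b * node_content ?t * ?b'))"
    by (simp add: op_g_single op_g_add diag_op_add tableau_perm_transpose_apply f[OF T] f'')
  also have "\<dots> = Poly_Mapping.single T (c * (?a * (?a * node_content ?s) + ?b * ?b' * node_content ?t)) +
      Poly_Mapping.single ?S (c * ?b * (?a * node_content ?s + ?a' * node_content ?t))"
    by (simp add: single_add[symmetric] algebra_simps)
  also have "?a * node_content ?s + ?a' * node_content ?t = 0"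
    by (rule coeff_diag_content[OF sep])
  also have "?a * (?a * node_content ?s) + ?b * ?b' * node_content ?t =
      node_content ?t + ?a * (?a * node_content ?s + ?a' * node_content ?t)"
    unfolding coeff_swap_mult[OF sep] by (simp add: algebra_simps)
  also have "\<dots> = node_content ?t"
    unfolding coeff_diag_content[OF sep] by simp
  finally show ?thesis
    by simp
qed

lemmas ev_simps = ev_diff ev_mult ev_letter ev_add ev_1 ev_scalar op_g_single op_g_add diag_op_add
  tableau_perm_transpose_apply

section \<open>Verification of the defining relations\<close>

lemma relation_g_far:
  assumes "1 \<le> i" "i < n" "1 \<le> j" "j < n" "i + 1 < j \<or> j + 1 < i"
  shows "ev (yh_g i * yh_g j - yh_g j * yh_g i) (Poly_Mapping.single T 1) = 0"
proof -
  have "swap_entries (swap_entries T i) j = swap_entries (swap_entries T j) i"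
    using assms by (auto simp: tableau_perm_transpose transpose_def fun_eq_iff)
  moreover have "transpose i (i + 1) j = j" "transpose i (i + 1) (j + 1) = j + 1"
    "transpose j (j + 1) i = i" "transpose j (j + 1) (i + 1) = i + 1"
    using assms by (auto simp: transpose_def)
  ultimately show ?thesis
    using assms by (simp add: ev_simps ac_simps)
qed

text \<open>Both sides are expanded over the six rearrangements of three entries. The coefficients
  at \<open>T\<close>, \<open>s T\<close> and \<open>r T\<close> are matched by the three braid
  identities; the other three agree factor by factor.\<close>

lemma relation_g_braid:
  assumes T: "T \<in> Std" and i: "1 \<le> i" "i + 1 < n"
  shows "ev (yh_g i * yh_g (i + 1) * yh_g i - yh_g (i + 1) * yh_g i * yh_g (i + 1))
    (Poly_Mapping.single T 1) = 0"
proof -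
  define j where "j = Suc i"
  define k where "k = Suc j"
  have ij: "i \<noteq> j" "j \<noteq> k" "i \<noteq> k" "j \<noteq> i" "k \<noteq> j" "k \<noteq> i"
    by (auto simp: j_def k_def)
  define x where "x = T i"
  define y where "y = T j"
  define z where "z = T k"
  have sep: "separated x y" "separated x z" "separated y z"
    unfolding x_def y_def z_def j_def k_def by (rule std_separated[OF T]; use i in simp)+
  define s where "s S = tableau_perm S (transpose i j)" for S :: "'m dm_tableau"
  define r where "r S = tableau_perm S (transpose j k)" for S :: "'m dm_tableau"
  have s_at: "s S i = S j" "s S j = S i" "s S k = S k" and r_at: "r S i = S i" "r S j = S k" "r S k = S j"
    and ss: "s (s S) = S" and rr: "r (r S) = S" for S
    using ij by (simp_all add: s_def r_def tableau_perm_transpose_apply)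
  have srs: "r (s (r T)) = s (r (s T))"
    using ij by (auto simp: fun_eq_iff s_def r_def tableau_perm_transpose_apply transpose_def)
  have gi: "op_g i (Poly_Mapping.single S c) = Poly_Mapping.single S (c * coeff_diag (S i) (S j)) +
      Poly_Mapping.single (s S) (c * coeff_swap (S i) (S j))"
    and gj: "op_g j (Poly_Mapping.single S c) = Poly_Mapping.single S (c * coeff_diag (S j) (S k)) +
      Poly_Mapping.single (r S) (c * coeff_swap (S j) (S k))" for S c
    by (simp_all add: op_g_single s_def r_def j_def k_def)
  note braid = coeff_braid_1[OF sep] coeff_braid_2[OF sep] coeff_braid_3[OF sep]
  let ?a = coeff_diag and ?b = coeff_swap
  have "op_g i (op_g j (op_g i (Poly_Mapping.single T 1))) =
      Poly_Mapping.single T (?a x y * ?a y z * ?a x y + ?b x y * ?a x z * ?b y x) +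
      Poly_Mapping.single (s T) (?b x y * (?a x y * ?a y z + ?a x z * ?a y x)) +
      Poly_Mapping.single (r T) (?b y z * (?a x y * ?a x z)) +
      Poly_Mapping.single (s (r T)) (?a x y * ?b y z * ?b x z) +
      Poly_Mapping.single (r (s T)) (?b x y * ?b x z * ?a y z) +
      Poly_Mapping.single (s (r (s T))) (?b x y * ?b x z * ?b y z)"
    by (simp add: gi gj op_g_add s_at r_at ss x_def[symmetric] y_def[symmetric] z_def[symmetric]
        single_add algebra_simps)
  also have "\<dots> = op_g j (op_g i (op_g j (Poly_Mapping.single T 1)))"
    unfolding braid
    by (simp add: gi gj op_g_add s_at r_at ss rr srs x_def[symmetric] y_def[symmetric] z_def[symmetric]
        single_add algebra_simps)
  finally show ?thesis
    using i by (simp add: ev_diff ev_mult ev_letter j_def)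
qed

text \<open>The Cayley-Hamilton identity for a 2 by 2 matrix with determinant -1 and trace
  \<open>\<kappa> * \<delta>\<close>, where \<open>\<delta>\<close> is the eigenvalue of
  e_i.\<close>

lemma relation_g_square:
  assumes T: "T \<in> Std" and i: "1 \<le> i" "i < n"
  shows "ev (yh_g i ^ 2 - (1 + scalar (laurent_q 1 - laurent_q (- 1)) * yh_e d i * yh_g i))
    (Poly_Mapping.single T 1) = 0"
proof -
  let ?s = "T i" and ?t = "T (Suc i)"
  let ?a = "coeff_diag ?s ?t" and ?b = "coeff_swap ?s ?t"
    and ?a' = "coeff_diag ?t ?s" and ?b' = "coeff_swap ?t ?s"
  let ?S = "tableau_perm T (transpose i (Suc i))"
  define \<kappa> :: "'m ratfun" where "\<kappa> = frac_q - inverse frac_q"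
  define \<delta> :: "'m ratfun" where "\<delta> = (if node_pos ?s = node_pos ?t then 1 else 0)"
  note sep = std_separated_Suc[OF T i]
  have \<kappa>: "to_fract (laurent_q 1 - laurent_q (- 1)) = \<kappa>"
    using laurent_q_inverse[of 1, where 'a = 'm] by (simp add: \<kappa>_def)
  have a: "?a' = \<kappa> * \<delta> - ?a"
    using coeff_diag_add[OF sep] by (auto simp: \<kappa>_def \<delta>_def algebra_simps split: if_splits)
  have b: "?b * ?b' = 1 + ?a * ?a'"
    by (rule coeff_swap_mult[OF sep])
  have e: "ev (yh_e d i) (Poly_Mapping.single T c) = Poly_Mapping.single T (c * \<delta>)" for c
    using ev_e[OF T i] by (simp add: \<delta>_def)
  have e': "ev (yh_e d i) (Poly_Mapping.single ?S (c * ?b)) = Poly_Mapping.single ?S (c * ?b * \<delta>)" for c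
  proof (cases "?S \<in> Std")
    case True
    then show ?thesis
      using ev_e[OF _ i, of ?S] by (auto simp: \<delta>_def tableau_perm_transpose_apply)
  next
    case False
    then show ?thesis
      using coeff_swap_nonstandard[OF T i] linear_on_0[OF linear_ev] by simp
  qed
  have "ev (yh_g i ^ 2) (Poly_Mapping.single T 1) =
      Poly_Mapping.single T (?a * ?a + ?b * ?b') + Poly_Mapping.single ?S (?b * (?a + ?a'))"
    using i by (simp add: ev_simps power2_eq_square single_add algebra_simps)
  also have "\<dots> = Poly_Mapping.single T (1 + \<kappa> * (?a * \<delta>)) + Poly_Mapping.single ?S (\<kappa> * (?b * \<delta>))"
    unfolding b a by (simp add: algebra_simps)
  also have "\<dots> = ev (1 + scalar (laurent_q 1 - laurent_q (- 1)) * yh_e d i * yh_g i) (Poly_Mapping.single T 1)"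
    using i e[of ?a] e'[of 1]
    by (simp add: ev_mult ev_letter ev_add ev_1 ev_scalar op_g_single ev_plus \<kappa> vs.scale_right_distrib
        single_add algebra_simps del: to_fract_diff)
  finally show ?thesis
    by (simp add: ev_diff)
qed

text \<open>The diagonal part of g_i is nonzero only if \<open>i\<close> and \<open>i + 1\<close>
  lie in one component, and then exchanging them does not change the eigenvalue of t_j.\<close>

lemma relation_t_g:
  assumes i: "1 \<le> i" "i < n"
  shows "ev (yh_t j * yh_g i - yh_g i * yh_t (transpose i (i + 1) j)) (Poly_Mapping.single T 1) = 0"
proof -
  have "coeff_diag (T i) (T (Suc i)) = 0 \<or> root_value \<xi> (T (transpose i (Suc i) j)) = root_value \<xi> (T j)"
    by (auto simp: root_value_def transpose_def coeff_diag_def)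
  then show ?thesis
    using i by (auto simp: ev_simps ac_simps)
qed

text \<open>The operator of g_1 X_1 g_1 is diagonal on standard tableaux, so it commutes with
  X_1.\<close>

lemma relation_X_g1:
  assumes T: "T \<in> Std" and n: "1 < n"
  shows "ev (yh_X * yh_g 1 * yh_X * yh_g 1 - yh_g 1 * yh_X * yh_g 1 * yh_X) (Poly_Mapping.single T 1) = 0"
proof -
  have "op_g 1 (diag_op (\<lambda>T. node_content (T 1)) (op_g 1 (Poly_Mapping.single T c)))
      = Poly_Mapping.single T (c * node_content (T (1 + 1)))" for c
    by (rule op_g_conj_diag[OF T]) (use n in auto)
  then show ?thesis
    using n by (simp add: ev_diff ev_mult ev_letter ac_simps)
qed

lemma relation_X_g:
  assumes "2 \<le> i" "i < n"
  shows "ev (yh_X * yh_g i - yh_g i * yh_X) (Poly_Mapping.single T 1) = 0"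
  using assms by (simp add: ev_simps ac_simps transpose_def)

text \<open>The corner of a diagram precedes all its other nodes, so otherwise the corner would hold
  an entry smaller than 1. Consequently the content of \<open>T 1\<close> is one of the parameters
  and a cyclotomic factor vanishes.\<close>

lemma first_node:
  assumes T: "T \<in> Std"
  shows "fst (T 1) = (1, 1)"
proof (rule ccontr)
  assume ne: "fst (T 1) \<noteq> (1, 1)"
  define s where "s = ((1 :: nat, 1 :: nat), snd (T 1))"
  have "T 1 \<in> dm_nodes d \<Lambda>"
    using std_node[OF T, of 1] n_pos by simp
  note pos = dm_nodes_pos[OF this]
  have "s \<in> dm_nodes d \<Lambda>"
    by (rule dm_nodes_downward[OF shape \<open>T 1 \<in> dm_nodes d \<Lambda>\<close>]) (use pos in \<open>auto simp: s_def\<close>)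
  then obtain j where j: "j \<in> {1..n}" "T j = s"
    using std_image[OF T] by force
  have "node_less s (T 1)"
    using pos ne by (auto simp: node_less_def s_def prod_eq_iff)
  then show False
    using std_less[OF T j(1), of 1] j n_pos by auto
qed

lemma relation_cyclotomic:
  assumes T: "T \<in> Std"
  shows "ev (prod_list (map (\<lambda>l. yh_X - scalar (laurent_v l)) (sorted_list_of_set UNIV)))
    (Poly_Mapping.single T 1) = 0"
proof -
  have ev_prod: "ev (prod_list (map (\<lambda>l. yh_X - scalar (laurent_v l)) xs)) (Poly_Mapping.single T c) =
      Poly_Mapping.single T (c * prod_list (map (\<lambda>l. node_content (T 1) - to_fract (laurent_v l)) xs))"
    for xs c
    by (induction xs arbitrary: c)
      (simp_all add: ev_1 ev_mult ev_diff ev_letter ev_scalar single_diff[symmetric] algebra_simps)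
  have "node_content (T 1) = to_fract (laurent_v (snd (snd (T 1))))"
    using first_node[OF T] by (simp add: node_content_eq node_diag_def laurent_q_0)
  then have "prod_list (map (\<lambda>l. node_content (T 1) - to_fract (laurent_v l)) (sorted_list_of_set UNIV)) = 0"
    by (auto simp: prod_list_zero_iff)
  then show ?thesis
    by (simp add: ev_prod)
qed

lemma relators_vanish:
  assumes "p \<in> yh_relators d n" and "v \<in> V"
  shows "ev p v = 0"
proof -
  have "ev p (Poly_Mapping.single T 1) = 0" if T: "T \<in> Std" for T
    using assms(1)
  proof cases
    case (g_far i j)
    then show ?thesis using relation_g_far by simp
  next
    case (g_braid i)
    then show ?thesis using relation_g_braid[OF T, of i] by simp
  next
    case (t_t i j)
    then show ?thesis by (simp add: ev_diff ev_mult ev_letter ac_simps)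
  next
    case (t_g j i)
    then show ?thesis using relation_t_g[of i j T] by simp
  next
    case (t_order j)
    have "ev (yh_t j) = diag_op (\<lambda>T. root_value \<xi> (T j))"
      by (simp add: fun_eq_iff ev_letter)
    moreover have "root_value \<xi> (T j) ^ d = 1"
      using root_power[OF T, of j] t_order
      by (simp add: root_value_def to_fract_power[symmetric] laurent_const_power laurent_const_hom)
    ultimately show ?thesis
      using t_order by (simp add: ev_diff ev_power ev_1 diag_op_power)
  next
    case (g_square i)
    then show ?thesis using relation_g_square[OF T, of i] by simp
  next
    case X_inverse_right
    then show ?thesis by (simp add: ev_diff ev_mult ev_letter ev_1 node_content_nonzero)
  next
    case X_inverse_left
    then show ?thesis by (simp add: ev_diff ev_mult ev_letter ev_1 node_content_nonzero)
  next
    case X_g1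
    then show ?thesis using relation_X_g1[OF T] by simp
  next
    case (X_g i)
    then show ?thesis using relation_X_g[of i T] by simp
  next
    case (X_t j)
    then show ?thesis by (simp add: ev_diff ev_mult ev_letter ac_simps)
  next
    case X_cyclotomic
    then show ?thesis using relation_cyclotomic[OF T] by simp
  qed
  then show ?thesis
    using linear_eq_on_V[OF linear_on_subset[OF linear_ev], of UNIV "\<lambda>v. 0" v p] assms(2)
    by (simp add: linear_on_def)
qed

section \<open>Passage to the algebra over the fraction field\<close>

lemma yh_ideal: "ideal (yh_ideal d n) (yh_free_algebra n :: ('m laurent, 'm yh_free) module)"
  unfolding yh_ideal_def using yh_relators_subset
  by (intro ring.genideal_ideal) (auto simp: yh_free_algebra_def free_algebra_ring)

text \<open>The polynomials annihilating \<open>V\<close> form an ideal containing the relators,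
  hence contain the ideal they generate.\<close>

lemma yh_ideal_vanishes:
  assumes "p \<in> yh_ideal d n" "v \<in> V"
  shows "ev p v = 0"
proof -
  have "yh_ideal d n \<subseteq> {p \<in> carrier (yh_free_algebra n). \<forall>v\<in>V. ev p v = 0}"
    unfolding yh_ideal_def using yh_relators_subset relators_vanish
    by (intro ring.genideal_minimal)
      (auto simp: yh_free_algebra_def free_algebra_ring killing_ideal subspace_V yh_op_V)
  then show ?thesis
    using assms by blast
qed

lemma yh_algebra_closed: "algebra_closed (yh_algebra d n :: ('m laurent, 'm yh_free set) module)"
  using yh_ideal unfolding yh_algebra_def yh_free_algebra_def by (rule quotient_free_closed)

lemma coset_mem: "x \<in> yh_gens n \<Longrightarrow>
    yh_ideal d n +>\<^bsub>yh_free_algebra n\<^esub> letter x \<in> carrier (yh_algebra d n :: ('m laurent, 'm yh_free set) module)"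
proof -
  assume "x \<in> yh_gens n"
  then have "letter x \<in> carrier (yh_free_algebra n :: ('m laurent, 'm yh_free) module)"
    by (simp add: yh_free_algebra_def free_algebra_def)
  then show ?thesis
    unfolding yh_algebra_def quotient_algebra_simps(1) by blast
qed

lemma frac_yh_elem_mem: "x \<in> yh_gens n \<Longrightarrow>
    frac_yh_elem d n (letter x :: 'm yh_free) \<in> carrier (frac_yh_algebra d n)"
  unfolding frac_yh_elem_def frac_yh_algebra_def by (intro pure_tensor_mem coset_mem)

text \<open>Matches the operator with the prescribed formula: for a nonstandard exchange the zero
  sits in \<open>coeff_swap\<close> on one side and in \<open>V_vec\<close> on the other.\<close>

lemma op_g_V_vec:
  assumes T: "T \<in> Std" and i: "1 \<le> i" "i < n"
  shows "op_g i (Poly_Mapping.single T 1) =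
    (if node_pos (T i) \<noteq> node_pos (T (i + 1)) then V_vec d n \<Lambda> (swap_entries T i)
     else vscale (node_content (T (i + 1)) * (frac_q - inverse frac_q) /
            (node_content (T (i + 1)) - node_content (T i))) (V_vec d n \<Lambda> T) +
          vscale ((frac_q * node_content (T (i + 1)) - inverse frac_q * node_content (T i)) /
            (node_content (T (i + 1)) - node_content (T i))) (V_vec d n \<Lambda> (swap_entries T i)))"
proof -
  have off: "Poly_Mapping.single (swap_entries T i) (coeff_swap (T i) (T (i + 1))) =
      vscale (if node_pos (T i) \<noteq> node_pos (T (i + 1)) then 1
        else (frac_q * node_content (T (i + 1)) - inverse frac_q * node_content (T i)) /
          (node_content (T (i + 1)) - node_content (T i))) (V_vec d n \<Lambda> (swap_entries T i))"
  proof (cases "swap_entries T i \<in> Std")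
    case True
    then have "\<not> node_covers (T i) (T (i + 1))" "\<not> node_covers (T (i + 1)) (T i)"
      using swap_standard_iff[OF T i] not_covers_reverse[OF T i] by auto
    then show ?thesis
      using True by (simp add: V_vec_def coeff_swap_def)
  next
    case False
    then show ?thesis
      using coeff_swap_nonstandard[OF T i] by (simp add: V_vec_def)
  qed
  show ?thesis
    unfolding op_g_single mult_1_left off using T by (simp add: V_vec_def coeff_diag_def)
qed

text \<open>The evaluation descends modulo the ideal and then modulo the tensor relators; on the
  class of a generator it remains \<open>yh_op\<close>.\<close>

lemma action_exists: "\<exists>\<rho>. V_action d n \<xi> \<Lambda> \<rho>"
proof -
  let ?A = "yh_free_algebra n :: ('m laurent, 'm yh_free) module"
  interpret I: ideal "yh_ideal d n" ?A
    by (rule yh_ideal)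
  have free: "scalar_action to_fract ?A V ev"
    unfolding yh_free_algebra_def by (rule scalar_action_free[OF subspace_V yh_op_V])
  have closed: "algebra_closed ?A"
    unfolding yh_free_algebra_def by (rule free_algebra_closed)
  note hyps = free closed I.a_subset _ yh_ideal_vanishes
  have ne: "yh_ideal d n \<noteq> ({} :: 'm yh_free set)"
    using I.zero_closed I.a_subset additive_subgroup.zero_closed[OF I.additive_subgroup_axioms] by blast
  have quot: "scalar_action to_fract (yh_algebra d n) V (quotient_action ev)"
    unfolding yh_algebra_def by (rule scalar_action_quotient[OF hyps]) (auto simp: ne)
  have quot_val: "quotient_action ev (yh_ideal d n +>\<^bsub>?A\<^esub> letter x) v = yh_op n \<xi> x v"
    if "x \<in> yh_gens n" "v \<in> V" for x v
    using that ne
    by (subst quotient_action_coset[OF hyps]) (auto simp: ev_letter yh_free_algebra_def free_algebra_def)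
  define \<rho> where "\<rho> = quotient_action (tensor_action (quotient_action ev :: 'm yh_free set \<Rightarrow> _))"
  have rep: "representation (frac_yh_algebra d n) V \<rho>"
    unfolding frac_yh_algebra_def \<rho>_def by (rule representation_extend_scalars(1)[OF quot yh_algebra_closed])
  have val: "\<rho> (frac_yh_elem d n (letter x)) v = yh_op n \<xi> x v" if "x \<in> yh_gens n" "v \<in> V" for x v
    unfolding frac_yh_elem_def \<rho>_def
    using representation_extend_scalars(2)[OF quot yh_algebra_closed coset_mem[OF that(1)] that(2)]
      quot_val[OF that] by simp
  have "V_action d n \<xi> \<Lambda> \<rho>"
    unfolding V_action_def Let_def
  proof (intro conjI ballI allI impI rep)
    fix T assume T: "T \<in> Std"
    have v: "V_vec d n \<Lambda> T = Poly_Mapping.single T 1" "Poly_Mapping.single T 1 \<in> V"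
      using T by (simp_all add: V_vec_def single_mem_V)
    show "\<rho> (frac_yh_elem d n yh_X) (V_vec d n \<Lambda> T) = vscale (node_content (T 1)) (V_vec d n \<Lambda> T)"
      using v by (simp add: val yh_gens_def)
    show "\<rho> (frac_yh_elem d n (yh_t j)) (V_vec d n \<Lambda> T) =
        vscale (to_fract (laurent_const (\<xi> (node_pos (T j))))) (V_vec d n \<Lambda> T)" if "1 \<le> j \<and> j \<le> n" for j
      using v that by (simp add: val yh_gens_def root_value_def)
    fix i assume i: "1 \<le> i \<and> i < n"
    then have "\<rho> (frac_yh_elem d n (yh_g i)) (V_vec d n \<Lambda> T) = op_g i (Poly_Mapping.single T 1)"
      using v by (simp add: val yh_gens_def)
    then show "\<rho> (frac_yh_elem d n (yh_g i)) (V_vec d n \<Lambda> T) =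
        (if node_pos (T i) \<noteq> node_pos (T (i + 1)) then V_vec d n \<Lambda> (swap_entries T i)
         else vscale (node_content (T (i + 1)) * (frac_q - inverse frac_q) /
            (node_content (T (i + 1)) - node_content (T i))) (V_vec d n \<Lambda> T) +
          vscale ((frac_q * node_content (T (i + 1)) - inverse frac_q * node_content (T i)) /
            (node_content (T (i + 1)) - node_content (T i))) (V_vec d n \<Lambda> (swap_entries T i)))"
      using op_g_V_vec[OF T] i by simp
  qed
  then show ?thesis
    by blast
qed

end

section \<open>Jucys--Murphy operators\<close>

text \<open>\<open>jm_op i\<close> is the operator of the Jucys--Murphy element \<open>X\<^sub>i\<^sub>+\<^sub>1 = g\<^sub>i X\<^sub>i g\<^sub>i\<close>.\<close>

primrec jm_op :: "nat \<Rightarrow> ('m dm_tableau \<Rightarrow>\<^sub>0 'm::{finite,linorder} ratfun) \<Rightarrow> ('m dm_tableau \<Rightarrow>\<^sub>0 'm ratfun)" where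
  "jm_op 0 v = diag_op (\<lambda>T. node_content (T 1)) v"
| "jm_op (Suc i) v = op_g (Suc i) (jm_op i (op_g (Suc i) v))"

lemma linear_jm_op: "linear_on UNIV UNIV (jm_op i)"
proof (induction i)
  case 0
  show ?case
    using linear_diag_op by (simp add: linear_on_def)
next
  case (Suc i)
  show ?case
    using linear_on_comp[OF linear_op_g linear_on_comp[OF Suc linear_op_g]] by (simp add: linear_on_def)
qed

context yh_module
begin

text \<open>Induction by \<open>op_g_conj_diag\<close>: each conjugation moves the eigenvalue from
  the content of one entry to that of the next. The index starts at 0, so \<open>jm_op i\<close>
  reads entry \<open>Suc i\<close>.\<close>

lemma jm_op_diag:
  assumes "i < n" "v \<in> V"
  shows "jm_op i v = diag_op (\<lambda>T. node_content (T (Suc i))) v"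
  using assms
proof (induction i arbitrary: v)
  case 0
  show ?case by simp
next
  case (Suc i)
  show ?case
  proof (rule linear_eq_on_V[OF linear_on_subset[OF linear_jm_op] linear_on_subset[OF linear_diag_op] Suc.prems(2)])
    fix T assume T: "T \<in> Std"
    have "jm_op (Suc i) (Poly_Mapping.single T 1) =
        op_g (Suc i) (diag_op (\<lambda>S. node_content (S (Suc i))) (op_g (Suc i) (Poly_Mapping.single T 1)))"
      using Suc.IH[of "op_g (Suc i) (Poly_Mapping.single T 1)"] Suc.prems(1) op_g_V[of "Suc i"]
        single_mem_V[OF T] by simp
    also have "\<dots> = diag_op (\<lambda>T. node_content (T (Suc (Suc i)))) (Poly_Mapping.single T 1)"
      using op_g_conj_diag[OF T, of "Suc i" "\<lambda>S. node_content (S (Suc i))" 1] Suc.prems(1) by simp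
    finally show "jm_op (Suc i) (Poly_Mapping.single T 1)
        = diag_op (\<lambda>T. node_content (T (Suc (Suc i)))) (Poly_Mapping.single T 1)" .
  qed
qed

text \<open>Both sides are linear on \<open>V\<close> and agree on the basis. From here an arbitrary
  \<open>\<rho>\<close> is handled through concrete operators, without computing it on other
  elements of the algebra.\<close>

lemma action_values:
  assumes act: "V_action d n \<xi> \<Lambda> \<rho>" and v: "v \<in> V"
  shows "\<rho> (frac_yh_elem d n yh_X) v = diag_op (\<lambda>T. node_content (T 1)) v"
    and "1 \<le> j \<Longrightarrow> j \<le> n \<Longrightarrow> \<rho> (frac_yh_elem d n (yh_t j)) v = diag_op (\<lambda>T. root_value \<xi> (T j)) v"
    and "1 \<le> i \<Longrightarrow> i < n \<Longrightarrow> \<rho> (frac_yh_elem d n (yh_g i)) v = op_g i v"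
proof -
  have lin: "linear_on V V (\<rho> (frac_yh_elem d n (letter x)))" if "x \<in> yh_gens n" for x
    using act frac_yh_elem_mem[OF that] by (simp add: V_action_def representation_def)
  have vec: "V_vec d n \<Lambda> T = Poly_Mapping.single T 1" if "T \<in> Std" for T
    using that by (simp add: V_vec_def)
  show "\<rho> (frac_yh_elem d n yh_X) v = diag_op (\<lambda>T. node_content (T 1)) v"
    by (rule linear_eq_on_V[OF lin linear_on_subset[OF linear_diag_op] v])
      (use act vec in \<open>auto simp: V_action_def Let_def yh_gens_def\<close>)
  show "\<rho> (frac_yh_elem d n (yh_t j)) v = diag_op (\<lambda>T. root_value \<xi> (T j)) v" if "1 \<le> j" "j \<le> n"
    by (rule linear_eq_on_V[OF lin linear_on_subset[OF linear_diag_op] v])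
      (use act vec that in \<open>auto simp: V_action_def Let_def yh_gens_def root_value_def\<close>)
  show "\<rho> (frac_yh_elem d n (yh_g i)) v = op_g i v" if i: "1 \<le> i" "i < n"
  proof (rule linear_eq_on_V[OF lin linear_on_subset[OF linear_op_g] v])
    fix T assume T: "T \<in> Std"
    show "\<rho> (frac_yh_elem d n (yh_g i)) (Poly_Mapping.single T 1) = op_g i (Poly_Mapping.single T 1)"
      unfolding op_g_V_vec[OF T i] using act T i vec[OF T] unfolding V_action_def Let_def by metis
  qed (use i in \<open>simp add: yh_gens_def\<close>)
qed

definition invariant :: "('m dm_tableau \<Rightarrow>\<^sub>0 'm ratfun) set \<Rightarrow> bool" where
  "invariant W \<longleftrightarrow> vs.subspace W \<and> W \<subseteq> V \<and>
    (\<forall>i w. 1 \<le> i \<and> i < n \<and> w \<in> W \<longrightarrow> op_g i w \<in> W) \<and>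
    (\<forall>i w. i < n \<and> w \<in> W \<longrightarrow> diag_op (\<lambda>T. node_content (T (Suc i))) w \<in> W) \<and>
    (\<forall>i w. i < n \<and> w \<in> W \<longrightarrow> diag_op (\<lambda>T. root_value \<xi> (T (Suc i))) w \<in> W)"

text \<open>\<open>jm_op\<close> is built from operators of generators, so submodules are stable
  under it without naming the corresponding elements of the algebra.\<close>

lemma action_invariant:
  assumes act: "V_action d n \<xi> \<Lambda> \<rho>" and W: "vs.subspace W" "W \<subseteq> V"
    and inv: "\<And>a. a \<in> carrier (frac_yh_algebra d n) \<Longrightarrow> \<rho> a ` W \<subseteq> W"
  shows "invariant W"
proof -
  have gen: "\<rho> (frac_yh_elem d n (letter x)) w \<in> W" if "x \<in> yh_gens n" "w \<in> W" for x w
    using inv[OF frac_yh_elem_mem[OF that(1)]] that(2) by blast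
  have g: "op_g i w \<in> W" if "1 \<le> i" "i < n" "w \<in> W" for i w
    using gen[of "Gen_g i" w] action_values(3)[OF act _ that(1,2), of w] that W(2) by (auto simp: yh_gens_def)
  have jm: "jm_op i w \<in> W" if "i < n" "w \<in> W" for i w
    using that
  proof (induction i arbitrary: w)
    case 0
    then show ?case
      using gen[of Gen_X w] action_values(1)[OF act, of w] W(2) by (auto simp: yh_gens_def)
  next
    case (Suc i)
    then show ?case
      by (simp add: g)
  qed
  have t: "diag_op (\<lambda>T. root_value \<xi> (T (Suc i))) w \<in> W" if "i < n" "w \<in> W" for i w
    using gen[of "Gen_t (Suc i)" w] action_values(2)[OF act, of w "Suc i"] that W(2) by (auto simp: yh_gens_def)
  have "diag_op (\<lambda>T. node_content (T (Suc i))) w \<in> W" if "i < n" "w \<in> W" for i w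
    using jm[OF that] jm_op_diag[OF that(1) subsetD[OF W(2) that(2)]] by simp
  then show ?thesis
    unfolding invariant_def using W g t by blast
qed

end

text \<open>Contents give \<open>l\<close> and the diagonal, roots of unity give \<open>k\<close>.
  Two shapes are allowed so that the same fact yields irreducibility and non-isomorphism.\<close>

lemma eigenvalues_separate:
  assumes "yh_module d n \<Lambda> \<xi>" and "yh_module d n \<Lambda>' \<xi>"
    and T: "T \<in> standard_tableaux d n \<Lambda>" and S: "S \<in> standard_tableaux d n \<Lambda>'"
    and eq: "\<And>i. i < n \<Longrightarrow> node_content (T (Suc i)) = node_content (S (Suc i)) \<and>
      root_value \<xi> (T (Suc i)) = root_value \<xi> (S (Suc i))"
  shows "T = S" and "\<Lambda> = \<Lambda>'"
proof -
  interpret T: yh_module d n \<Lambda> \<xi> by fact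
  interpret S: yh_module d n \<Lambda>' \<xi> by fact
  have "snd (T i) = snd (S i) \<and> node_diag (T i) = node_diag (S i)" if i: "i \<in> {1..n}" for i
  proof -
    have "i - 1 < n" "Suc (i - 1) = i"
      using i by auto
    then show ?thesis
      using eq[of "i - 1"] T.root_inj[OF T.std_node[OF T i] S.std_node[OF S i]]
      by (auto simp: node_content_eq_iff node_pos_eq prod_eq_iff)
  qed
  from tableau_determined[OF T.shape S.shape T S this] show "T = S" "\<Lambda> = \<Lambda>'"
    by auto
qed

section \<open>Irreducibility\<close>

context yh_module
begin

text \<open>A nonzero vector of minimal support is a joint eigenvector, since otherwise its support
  could be shortened; as eigenvalues separate tableaux, the support is one tableau.\<close>

lemma invariant_contains_single:
  assumes W: "invariant W" and ne: "W \<noteq> {0}"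
  shows "\<exists>T\<in>Std. Poly_Mapping.single T 1 \<in> W"
proof -
  have sub: "vs.subspace W" "W \<subseteq> V"
    using W by (auto simp: invariant_def)
  obtain w where w: "w \<in> W" "w \<noteq> 0"
    and min: "\<And>w'. w' \<in> W \<Longrightarrow> w' \<noteq> 0 \<Longrightarrow> card (Poly_Mapping.keys w) \<le> card (Poly_Mapping.keys w')"
    using ne vs.subspace_0[OF sub(1)]
      ex_has_least_nat[of "\<lambda>w. w \<in> W \<and> w \<noteq> 0" _ "\<lambda>w. card (Poly_Mapping.keys w)"] by blast
  then obtain T where T: "T \<in> Poly_Mapping.keys w"
    by (metis all_not_in_conv keys_eq_empty)
  have std: "U \<in> Std" if "U \<in> Poly_Mapping.keys w" for U
    using that w(1) sub(2) by (auto simp: V_space_def)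
  have diag: "f S = f T" if f: "\<And>w. w \<in> W \<Longrightarrow> diag_op f w \<in> W" and S: "S \<in> Poly_Mapping.keys w" for f S
  proof (rule ccontr)
    assume ne: "f S \<noteq> f T"
    \<comment> \<open>This loses the coordinate at \<open>S\<close> and keeps the one at
      \<open>T\<close>, giving a nonzero vector of smaller support.\<close>
    let ?w = "diag_op f w - vscale (f S) w"
    have look: "Poly_Mapping.lookup ?w U = (f U - f S) * Poly_Mapping.lookup w U" for U
      by (simp add: lookup_minus algebra_simps)
    have "?w \<in> W"
      by (intro vs.subspace_diff[OF sub(1)] vs.subspace_scale[OF sub(1)] f w(1))
    moreover have "T \<in> Poly_Mapping.keys ?w"
      using T ne by (simp add: in_keys_iff look)
    moreover have "Poly_Mapping.keys ?w \<subseteq> Poly_Mapping.keys w - {S}"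
      by (auto simp: in_keys_iff look)
    then have "card (Poly_Mapping.keys ?w) < card (Poly_Mapping.keys w)"
      using S by (intro psubset_card_mono) auto
    ultimately show False
      using min[of ?w] by (metis keys_zero empty_iff leD)
  qed
  have keys: "Poly_Mapping.keys w = {T}"
  proof -
    have "S = T" if "S \<in> Poly_Mapping.keys w" for S
    proof (rule eigenvalues_separate(1)[OF yh_module_axioms yh_module_axioms std[OF that] std[OF T]])
      fix i assume i: "i < n"
      show "node_content (S (Suc i)) = node_content (T (Suc i)) \<and>
          root_value \<xi> (S (Suc i)) = root_value \<xi> (T (Suc i))"
        using diag[OF _ that, of "\<lambda>T. node_content (T (Suc i))"]
          diag[OF _ that, of "\<lambda>T. root_value \<xi> (T (Suc i))"] W i unfolding invariant_def by blast
    qed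
    then show ?thesis
      using T by blast
  qed
  define c where "c = Poly_Mapping.lookup w T"
  have "w = Poly_Mapping.single T c"
    using sum_single_lookup[of w] keys by (simp add: c_def)
  moreover have "c \<noteq> 0"
    using T by (simp add: c_def in_keys_iff)
  ultimately have "Poly_Mapping.single T 1 = vscale (inverse c) w"
    by simp
  then show ?thesis
    using vs.subspace_scale[OF sub(1) w(1), of "inverse c"] std[OF T] by metis
qed

text \<open>Along an admissible exchange, subtracting the diagonal part of g_i and dividing by the
  nonzero \<open>coeff_swap\<close> leaves the neighbouring basis vector.\<close>

lemma invariant_eq_V:
  assumes W: "invariant W" and ne: "W \<noteq> {0}"
  shows "W = V"
proof
  have sub: "vs.subspace W" "W \<subseteq> V"
    using W by (auto simp: invariant_def)
  then show "W \<subseteq> V" by simp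
  obtain T where T: "T \<in> Std" "Poly_Mapping.single T 1 \<in> W"
    using invariant_contains_single[OF assms] by blast
  have mem: "Poly_Mapping.single S 1 \<in> W" if S: "S \<in> Std" for S
  proof (rule std_swap_induct[OF T(1) S, where P = "\<lambda>S. Poly_Mapping.single S 1 \<in> W", OF T(2)])
    fix T i
    assume step: "T \<in> Std" "1 \<le> i" "i < n" "swap_entries T i \<in> Std" "Poly_Mapping.single T 1 \<in> W"
    let ?a = "coeff_diag (T i) (T (i + 1))" and ?b = "coeff_swap (T i) (T (i + 1))"
    have "\<not> node_covers (T i) (T (i + 1))" "\<not> node_covers (T (i + 1)) (T i)"
      using swap_standard_iff[OF step(1-3)] not_covers_reverse[OF step(1-3)] step(4) by auto
    then have b: "?b \<noteq> 0"
      using adjacent_diag_covers[OF step(1-3)] std_separated_Suc[OF step(1-3)]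
      by (intro coeff_swap_nonzero) auto
    have "op_g i (Poly_Mapping.single T 1) - vscale ?a (Poly_Mapping.single T 1) \<in> W"
      using W step(2,3,5) by (intro vs.subspace_diff vs.subspace_scale sub) (auto simp: invariant_def)
    also have "op_g i (Poly_Mapping.single T 1) - vscale ?a (Poly_Mapping.single T 1)
        = Poly_Mapping.single (swap_entries T i) ?b"
      by (simp add: op_g_single)
    finally have "vscale (inverse ?b) (Poly_Mapping.single (swap_entries T i) ?b) \<in> W"
      by (rule vs.subspace_scale[OF sub(1)])
    then show "Poly_Mapping.single (swap_entries T i) 1 \<in> W"
      using b by simp
  qed
  show "V \<subseteq> W"
  proof
    fix v assume v: "v \<in> V"
    have "(\<Sum>T\<in>Poly_Mapping.keys v. vscale (Poly_Mapping.lookup v T) (Poly_Mapping.single T 1)) \<in> W"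
      using v mem by (intro vs.subspace_sum vs.subspace_scale sub) (auto simp: V_space_def)
    then show "v \<in> W"
      using basis_expansion[of v] by simp
  qed
qed

lemma V_nonzero: "V \<noteq> {0}"
proof -
  obtain T where "T \<in> Std"
    using standard_tableau_exists[OF shape] by blast
  then have "Poly_Mapping.single T 1 \<in> V"
    by (rule single_mem_V)
  moreover have "Poly_Mapping.single T (1 :: 'm ratfun) \<noteq> 0"
    by (simp add: single_eq_0_iff)
  ultimately show ?thesis
    by blast
qed

lemma action_irreducible:
  assumes "V_action d n \<xi> \<Lambda> \<rho>"
  shows "irreducible_rep (frac_yh_algebra d n) V \<rho>"
  unfolding irreducible_rep_def
proof (intro conjI allI impI V_nonzero)
  show "representation (frac_yh_algebra d n) V \<rho>"
    using assms by (simp add: V_action_def)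
  fix W assume "vs.subspace W \<and> W \<subseteq> V \<and> (\<forall>a\<in>carrier (frac_yh_algebra d n). \<rho> a ` W \<subseteq> W)"
  then show "W = {0} \<or> W = V"
    using invariant_eq_V action_invariant[OF assms] by blast
qed

end

text \<open>An isomorphism sends a basis vector to a nonzero joint eigenvector with the same
  eigenvalues, and every tableau in the support of that image must carry them.\<close>

lemma isomorphic_shapes_eq:
  assumes "yh_module d n \<Lambda> \<xi>" and "yh_module d n \<Lambda>' \<xi>"
    and \<rho>: "V_action d n \<xi> \<Lambda> \<rho>" and \<sigma>: "V_action d n \<xi> \<Lambda>' \<sigma>"
    and iso: "isomorphic_reps (frac_yh_algebra d n) (V_space d n \<Lambda>) \<rho> (V_space d n \<Lambda>') \<sigma>"
  shows "\<Lambda> = \<Lambda>'"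
proof -
  interpret A: yh_module d n \<Lambda> \<xi> by fact
  interpret B: yh_module d n \<Lambda>' \<xi> by fact
  obtain \<phi> where lin: "linear_on A.V B.V \<phi>" and bij: "bij_betw \<phi> A.V B.V"
    and comm: "\<And>a v. a \<in> carrier (frac_yh_algebra d n) \<Longrightarrow> v \<in> A.V \<Longrightarrow> \<phi> (\<rho> a v) = \<sigma> a (\<phi> v)"
    using iso unfolding isomorphic_reps_def by blast
  have mem: "\<phi> v \<in> B.V" if "v \<in> A.V" for v
    using lin that by (rule linear_on_mem)
  have gen: "\<phi> (\<rho> (frac_yh_elem d n (letter x)) v) = \<sigma> (frac_yh_elem d n (letter x)) (\<phi> v)"
    if "x \<in> yh_gens n" "v \<in> A.V" for x v
    using comm[OF A.frac_yh_elem_mem[OF that(1)] that(2)] .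
  have g: "\<phi> (op_g i v) = op_g i (\<phi> v)" if "1 \<le> i" "i < n" "v \<in> A.V" for i v
    using gen[of "Gen_g i" v] A.action_values(3)[OF \<rho> that(3,1,2)]
      B.action_values(3)[OF \<sigma> mem[OF that(3)] that(1,2)] that by (simp add: yh_gens_def)
  have jm: "\<phi> (jm_op i v) = jm_op i (\<phi> v)" if "i < n" "v \<in> A.V" for i v
    using that
  proof (induction i arbitrary: v)
    case 0
    then show ?case
      using gen[of Gen_X v] A.action_values(1)[OF \<rho>, of v] B.action_values(1)[OF \<sigma> mem, of v]
      by (simp add: yh_gens_def)
  next
    case (Suc i)
    \<comment> \<open>\<open>\<phi>\<close> intertwines the actions on \<open>A.V\<close> only, so
      each intermediate vector has to be shown to lie there.\<close>
    have "jm_op i (op_g (Suc i) v) \<in> A.V"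
      using Suc.prems A.op_g_V[of "Suc i" v] A.jm_op_diag[of i "op_g (Suc i) v"] A.diag_op_V by simp
    then show ?case
      using Suc g[of "Suc i"] A.op_g_V[of "Suc i" v] by simp
  qed
  have t: "\<phi> (diag_op (\<lambda>T. root_value \<xi> (T (Suc i))) v) = diag_op (\<lambda>T. root_value \<xi> (T (Suc i))) (\<phi> v)"
    if "i < n" "v \<in> A.V" for i v
    using gen[of "Gen_t (Suc i)" v] A.action_values(2)[OF \<rho>, of v "Suc i"]
      B.action_values(2)[OF \<sigma> mem, of v "Suc i"] that by (simp add: yh_gens_def)
  obtain T where T: "T \<in> A.Std"
    using standard_tableau_exists[OF A.shape] by blast
  define e where "e = Poly_Mapping.single T (1 :: 'a ratfun)"
  have e: "e \<in> A.V"
    unfolding e_def by (rule A.single_mem_V[OF T])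
  have "\<phi> e \<noteq> 0"
  proof
    assume "\<phi> e = 0"
    then have "\<phi> e = \<phi> 0"
      using linear_on_0[OF lin] vs.subspace_0[OF A.subspace_V] by simp
    then have "e = 0"
      using bij e vs.subspace_0[OF A.subspace_V] by (auto simp: bij_betw_def dest: inj_onD)
    then show False
      by (simp add: e_def single_eq_0_iff)
  qed
  then obtain S where S: "S \<in> Poly_Mapping.keys (\<phi> e)"
    by (metis all_not_in_conv keys_eq_empty)
  then have S_std: "S \<in> B.Std"
    using mem[OF e] by (auto simp: V_space_def)
  have eigen: "f T = f S" if "\<phi> (diag_op f e) = diag_op f (\<phi> e)" for f
  proof -
    have "diag_op f e = vscale (f T) e"
      by (simp add: e_def)
    then have "vscale (f T) (\<phi> e) = diag_op f (\<phi> e)"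
      using that linear_on_scale[OF lin e] by simp
    from arg_cong[OF this, of "\<lambda>v. Poly_Mapping.lookup v S"]
    have "f T * Poly_Mapping.lookup (\<phi> e) S = f S * Poly_Mapping.lookup (\<phi> e) S"
      by simp
    then show ?thesis
      using S by (simp add: in_keys_iff)
  qed
  show ?thesis
  proof (rule eigenvalues_separate(2)[OF assms(1,2) T S_std])
    fix i assume i: "i < n"
    show "node_content (T (Suc i)) = node_content (S (Suc i)) \<and>
        root_value \<xi> (T (Suc i)) = root_value \<xi> (S (Suc i))"
      using eigen[of "\<lambda>T. node_content (T (Suc i))"] jm[OF i e] A.jm_op_diag[OF i e]
        B.jm_op_diag[OF i mem[OF e]] eigen[of "\<lambda>T. root_value \<xi> (T (Suc i))"] t[OF i e] by simp
  qed
qed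

theorem proposition3p4:
  fixes d n :: nat and \<xi> :: "nat \<Rightarrow> complex"
  assumes "d > 0" and "n > 0"
    and "bij_betw \<xi> {1..d} {z. z ^ d = 1}"
  shows "(\<forall>\<Lambda> \<in> (multipartitions d n :: (nat \<Rightarrow> 'm::{finite,linorder} \<Rightarrow> nat list) set).
            \<exists>\<rho>. V_action d n \<xi> \<Lambda> \<rho>) \<and>
         (\<forall>\<Lambda> \<in> (multipartitions d n :: (nat \<Rightarrow> 'm \<Rightarrow> nat list) set). \<forall>\<rho>.
            V_action d n \<xi> \<Lambda> \<rho> \<longrightarrow>
              irreducible_rep (frac_yh_algebra d n) (V_space d n \<Lambda>) \<rho>) \<and>
         (\<forall>\<Lambda> \<in> (multipartitions d n :: (nat \<Rightarrow> 'm \<Rightarrow> nat list) set).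
            \<forall>\<Lambda>' \<in> multipartitions d n. \<forall>\<rho> \<sigma>.
              V_action d n \<xi> \<Lambda> \<rho> \<and> V_action d n \<xi> \<Lambda>' \<sigma> \<and> \<Lambda> \<noteq> \<Lambda>' \<longrightarrow>
                \<not> isomorphic_reps (frac_yh_algebra d n)
                    (V_space d n \<Lambda>) \<rho> (V_space d n \<Lambda>') \<sigma>)"
proof -
  have M: "yh_module d n \<Lambda> \<xi>" if "\<Lambda> \<in> multipartitions d n" for \<Lambda> :: "nat \<Rightarrow> 'm \<Rightarrow> nat list"
    using that assms by unfold_locales auto
  show ?thesis
    using yh_module.action_exists[OF M] yh_module.action_irreducible[OF M] isomorphic_shapes_eq[OF M M]
    by blast
qed

end
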